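(* Let $G$ be a finite simple graph on the vertex set $\{1,\dots,n\}$ with at least one edge, and let $I(G)\subset S=K[x_1,\dots,x_n]$ be its edge ideal, $K$ a field. Suppose that $I(G)$ has a linear resolution. Then $$\mathrm{v}(I(G)^k)=2k-1\quad\text{for all } k\ge1.$$
   Context: The edge ideal $I(G)$ is the ideal of $S$ generated by the monomials $x_ix_j$ with $\{i,j\}$ an edge of $G$. $S=\bigoplus_{d\ge0} S_d$ is standard graded ($\deg x_i=1$). For a graded ideal $I\subset S$, $\mathrm{Ass}(I)$ is the set of associated primes of $S/I$ and the v-number is $\mathrm{v}(I)=\min\{d: \exists f\in S_d\text{ with } (I:f)\in\mathrm{Ass}(I)\}$. $I$ has a linear resolution if it is generated in a single degree $d$ and its graded Betti numbers satisfy $\beta_{i,j}(I)=0$ for all $i\ge0$ and $j\neq i+d$. *)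

theory Defs
  imports
    "HOL-Library.Poly_Mapping"
    "HOL-Algebra.Ideal_Product"
    "HOL-Algebra.Algebraic_Closure_Type"
    "Jordan_Normal_Form.Matrix_Kernel"
begin

text \<open>
  The vertex set \<open>{1,\<dots>,n}\<close> is the universe of a finite type \<open>'v\<close>, and
  \<open>S = K[x\<^sub>i | i :: 'v]\<close> is the type of finitely supported functions from exponent
  vectors to coefficients, with the convolution product of \<^theory>\<open>HOL-Library.Poly_Mapping\<close>.
\<close>

type_synonym 'v monom = "'v \<Rightarrow>\<^sub>0 nat"
type_synonym ('v, 'k) mpoly = "'v monom \<Rightarrow>\<^sub>0 'k"

abbreviation mpoly_ring :: "('v::finite, 'k::field) mpoly ring" where
  "mpoly_ring \<equiv> ring_of_type_algebra"

definition mvar :: "'v \<Rightarrow> ('v::finite, 'k::field) mpoly" where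
  "mvar i = Poly_Mapping.single (Poly_Mapping.single i 1) 1"

definition monom_degree :: "'v::finite monom \<Rightarrow> nat" where
  "monom_degree m = (\<Sum>i\<in>UNIV. Poly_Mapping.lookup m i)"

definition graded_component :: "nat \<Rightarrow> ('v::finite, 'k::field) mpoly set" where
  "graded_component d = {f. \<forall>m\<in>Poly_Mapping.keys f. monom_degree m = d}"

definition edge_ideal :: "'v::finite set set \<Rightarrow> ('v, 'k::field) mpoly set" where
  "edge_ideal E = Idl\<^bsub>mpoly_ring\<^esub> {mvar i * mvar j | i j. {i, j} \<in> E}"

definition ideal_power ::
    "('v::finite, 'k::field) mpoly set \<Rightarrow> nat \<Rightarrow> ('v, 'k) mpoly set" where
  "ideal_power I k = I [^]\<^bsub>ideals_set mpoly_ring\<^esub> k"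

definition colon :: "('v::finite, 'k::field) mpoly set \<Rightarrow> ('v, 'k) mpoly \<Rightarrow> ('v, 'k) mpoly set" where
  "colon I f = {g. g * f \<in> I}"

text \<open>The annihilator of the class of \<open>f\<close> in \<open>S/I\<close> is \<open>(I : f)\<close>.\<close>

definition Ass :: "('v::finite, 'k::field) mpoly set \<Rightarrow> ('v, 'k) mpoly set set" where
  "Ass I = {P. primeideal P mpoly_ring \<and> (\<exists>f. P = colon I f)}"

definition v_number :: "('v::finite, 'k::field) mpoly set \<Rightarrow> nat" where
  "v_number I = (LEAST d. \<exists>f\<in>graded_component d. colon I f \<in> Ass I)"

text \<open>
  A minimal graded free resolution
  \<open>\<dots> \<rightarrow> F\<^sub>1 \<rightarrow> F\<^sub>0 \<rightarrow> I \<rightarrow> 0\<close> of an ideal \<open>I\<close> is given by bases and matrices: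
  \<open>F\<^sub>i\<close> is the direct sum of the modules \<open>S(-j)\<close>, with \<open>j\<close> running through the list \<open>s i\<close>
  (that is, \<open>s i ! b\<close> is the degree of the \<open>b\<close>-th basis element of \<open>F\<^sub>i\<close>);
  \<open>\<phi> (Suc i)\<close> is the matrix of the map \<open>F\<^bsub>i+1\<^esub> \<rightarrow> F\<^sub>i\<close>, and the
  one-row matrix \<open>\<phi> 0\<close> is the augmentation \<open>F\<^sub>0 \<rightarrow> I \<subseteq> S\<close>.
  All shifts can be taken in the natural numbers because \<open>I \<subseteq> S\<close> lives in degrees \<open>\<ge> 0\<close>.

  The conditions on the entries say that the maps are homogeneous of degree \<open>0\<close> and, in the
  last clause, that \<open>F\<^bsub>i+1\<^esub>\<close> is mapped into \<open>(x\<^sub>1,\<dots>,x\<^sub>n) F\<^sub>i\<close> (zero constant terms).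
\<close>

definition minimal_graded_free_resolution ::
    "('v::finite, 'k::field) mpoly set \<Rightarrow> (nat \<Rightarrow> nat list) \<Rightarrow>
     (nat \<Rightarrow> ('v, 'k) mpoly mat) \<Rightarrow> bool" where
  "minimal_graded_free_resolution I s \<phi> \<longleftrightarrow>
     \<phi> 0 \<in> carrier_mat 1 (length (s 0)) \<and>
     (\<forall>i. \<phi> (Suc i) \<in> carrier_mat (length (s i)) (length (s (Suc i)))) \<and>
     (\<forall>b<length (s 0). \<phi> 0 $$ (0, b) \<in> graded_component (s 0 ! b)) \<and>
     (\<forall>i. \<forall>a<length (s i). \<forall>b<length (s (Suc i)). \<forall>m\<in>Poly_Mapping.keys (\<phi> (Suc i) $$ (a, b)).
        monom_degree m + s i ! a = s (Suc i) ! b) \<and>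
     (\<lambda>u. vec_index (\<phi> 0 *\<^sub>v u) 0) ` carrier_vec (length (s 0)) = I \<and>
     (\<forall>i. mat_kernel (\<phi> i) = (\<lambda>u. \<phi> (Suc i) *\<^sub>v u) ` carrier_vec (length (s (Suc i)))) \<and>
     (\<forall>i. \<forall>a<length (s i). \<forall>b<length (s (Suc i)).
        Poly_Mapping.lookup (\<phi> (Suc i) $$ (a, b)) 0 = 0)"

text \<open>
  \<open>\<beta>\<close> is the table of graded Betti numbers of \<open>I\<close>: \<open>F\<^sub>i\<close> is the direct sum of the
  \<open>S(-j)\<^bsup>\<beta> i j\<^esup>\<close> in a minimal graded free resolution of \<open>I\<close>. This is a relation rather than
  a function of \<open>I\<close>; the table is determined by \<open>I\<close> since minimal graded free
  resolutions are unique up to isomorphism.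
\<close>

definition graded_betti_numbers ::
    "('v::finite, 'k::field) mpoly set \<Rightarrow> (nat \<Rightarrow> nat \<Rightarrow> nat) \<Rightarrow> bool" where
  "graded_betti_numbers I \<beta> \<longleftrightarrow>
     (\<exists>s \<phi>. minimal_graded_free_resolution I s \<phi> \<and> \<beta> = (\<lambda>i j. count_list (s i) j))"

definition has_linear_resolution :: "('v::finite, 'k::field) mpoly set \<Rightarrow> bool" where
  "has_linear_resolution I \<longleftrightarrow>
     (\<exists>d \<beta>. (\<exists>A\<subseteq>graded_component d. I = Idl\<^bsub>mpoly_ring\<^esub> A) \<and>
            graded_betti_numbers I \<beta> \<and> (\<forall>i j. j \<noteq> i + d \<longrightarrow> \<beta> i j = 0))"

end

theory Submission
  imports Defs "HOL-Library.Countable"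
begin

text \<open>
  Write \<open>I\<close> for the edge ideal and \<open>H\<close> for the complement of the graph.

  \<^emph>\<open>Lower bound.\<close> If \<open>P = (I\<^sup>k : f)\<close> is prime, then \<open>P\<close> contains \<open>(x\<^sub>i x\<^sub>j)\<^sup>k\<close> for an edge
  \<open>{i, j}\<close>, hence a variable \<open>x\<^sub>v\<close>. Now \<open>x\<^sub>v f\<close> is a nonzero element of \<open>I\<^sup>k\<close>, which lives in degrees
  at least \<open>2k\<close>, so \<open>deg f \<ge> 2k - 1\<close>.

  \<^emph>\<open>Upper bound.\<close> Suppose that some vertex \<open>y\<close> has a nonempty neighbourhood \<open>C\<close> that meets every edge.
  Then \<open>I\<close> is contained in the prime ideal \<open>P = (x\<^sub>v : v \<in> C)\<close>. Take \<open>y' \<in> C\<close> and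
  \<open>f = x\<^sub>y (x\<^sub>y x\<^sub>y\<^sub>')\<^bsup>k-1\<^esup>\<close>, of degree \<open>2k - 1\<close>. Clearly \<open>x\<^sub>v f \<in> I\<^sup>k\<close> for \<open>v \<in> C\<close>; conversely,
  if \<open>g f \<in> I\<^sup>k \<subseteq> P\<^sup>k\<close>, then counting the variables of \<open>C\<close> (of which \<open>f\<close> has only \<open>k - 1\<close>) gives
  \<open>g \<in> P\<close>. So \<open>(I\<^sup>k : f) = P\<close> (lemma \<open>v_number_witness\<close>).

  \<^emph>\<open>The vertex y.\<close> The neighbourhood of \<open>y\<close> meets every edge if and only if \<open>y\<close> is simplicial in \<open>H\<close>.
  By a theorem of Dirac, a chordal graph that is not complete has two nonadjacent simplicial vertices
  (lemma \<open>clique_or_two_simplicial\<close>); being nonadjacent in \<open>H\<close>, they form an edge of the graph. Chordality of \<open>H\<close>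
  is one direction of Froeberg's theorem, and is used in the following form: if \<open>a, b \<in> W\<close> are
  adjacent in \<open>H\<close> without a common neighbour in \<open>W\<close>, then deleting the edge \<open>ab\<close> disconnects \<open>a\<close>
  from \<open>b\<close> in \<open>H[W]\<close>.

  To prove this (lemma \<open>linear_edge_ideal_cut_chordal\<close>), consider the Koszul chain
  \<open>c = x\<^sub>a x\<^sub>b e\<^sub>\<sigma>\<close> with \<open>\<sigma> = W - {a, b}\<close>. Since \<open>a\<close> and \<open>b\<close> have no common \<open>H\<close>-neighbour in \<open>W\<close>, it is
  a cycle modulo \<open>I\<close>. Its boundary has degree at least \<open>3\<close>, and a linear resolution forces \<open>c\<close> to be
  a boundary modulo \<open>I\<close>: this is the vanishing of \<open>Tor\<close> outside the linear strand, obtained by a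
  diagram chase between the resolution and the Koszul complex of the variables (lemmas
  \<open>koszul_chase\<close> and \<open>linear_resolution_koszul_boundary\<close>). Reading off the coefficients of
  \<open>x\<^sub>u x\<^sub>v e\<^sub>\<tau>\<close>, \<open>\<tau> = W - {u, v}\<close>, for the edges \<open>uv\<close> of \<open>H[W]\<close> yields a function on \<open>W\<close> whose values
  agree along every edge of \<open>H[W]\<close> except \<open>ab\<close>, along which they differ.
\<close>

section \<open>Monomials and coefficients\<close>

lemma lookup_monomial_times:
  fixes f :: "('v::finite, 'k::field) mpoly"
  shows "Poly_Mapping.lookup (Poly_Mapping.single e 1 * f) (e + m) = Poly_Mapping.lookup f m"
proof -
  have "Poly_Mapping.lookup (Poly_Mapping.single e 1 * f) (e + m) =
      (\<Sum>l. (1 when e = l) * (\<Sum>q. Poly_Mapping.lookup f q when e + m = l + q))"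
    by (simp add: lookup_mult lookup_single)
  also have "\<dots> = (\<Sum>l. (\<Sum>q. Poly_Mapping.lookup f q when e + m = l + q) when l = e)"
    by (intro arg_cong[where f = Sum_any] ext) (auto simp: when_def)
  also have "\<dots> = Poly_Mapping.lookup f m"
    by (simp add: eq_commute[of m])
  finally show ?thesis .
qed

lemma keys_monomial_times:
  fixes f :: "('v::finite, 'k::field) mpoly"
  shows "Poly_Mapping.keys (Poly_Mapping.single e 1 * f) = (+) e ` Poly_Mapping.keys f"
proof -
  have "Poly_Mapping.keys (Poly_Mapping.single e 1 * f) \<subseteq> (+) e ` Poly_Mapping.keys f"
    using keys_mult[of "Poly_Mapping.single e 1" f] by auto
  then show ?thesis
    by (auto simp: in_keys_iff lookup_monomial_times)
qed

lemma monomial_minus_variable: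
  fixes m :: "'v::finite monom"
  assumes "Poly_Mapping.lookup m v \<noteq> 0"
  shows "Poly_Mapping.single v 1 + (m - Poly_Mapping.single v 1) = m"
  using assms by (intro poly_mapping_eqI) (auto simp: lookup_add lookup_minus lookup_single when_def)

lemma lookup_mvar_times:
  fixes f :: "('v::finite, 'k::field) mpoly"
  shows "Poly_Mapping.lookup (mvar v * f) m =
    (if Poly_Mapping.lookup m v = 0 then 0 else Poly_Mapping.lookup f (m - Poly_Mapping.single v 1))"
proof (cases "Poly_Mapping.lookup m v = 0")
  case True
  have "m \<notin> Poly_Mapping.keys (mvar v * f)"
    using True by (auto simp: mvar_def keys_monomial_times lookup_add)
  then show ?thesis using True by (simp add: in_keys_iff)
next
  case False
  then show ?thesis
    using lookup_monomial_times[of "Poly_Mapping.single v 1" f "m - Poly_Mapping.single v 1"]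
    by (simp add: mvar_def monomial_minus_variable del: One_nat_def)
qed

lemma monom_degree_add: "monom_degree (m + m') = monom_degree m + monom_degree m'"
  by (simp add: monom_degree_def lookup_add sum.distrib)

lemma monom_degree_single [simp]: "monom_degree (Poly_Mapping.single v n) = n"
  by (simp add: monom_degree_def lookup_single when_def)

lemma monom_degree_eq_0_iff: "monom_degree m = 0 \<longleftrightarrow> m = 0"
  by (auto simp: monom_degree_def poly_mapping_eq_iff fun_eq_iff)

section \<open>Ideals and their powers\<close>

lemma mpoly_ring_simps [simp]:
  "carrier mpoly_ring = UNIV" "x \<oplus>\<^bsub>mpoly_ring\<^esub> y = x + y" "x \<otimes>\<^bsub>mpoly_ring\<^esub> y = x * y"
  "\<zero>\<^bsub>mpoly_ring\<^esub> = 0" "\<one>\<^bsub>mpoly_ring\<^esub> = 1"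
  by (simp_all add: ring_of_type_algebra_def)

lemma cring_mpoly_ring: "cring (mpoly_ring :: ('v::finite, 'k::field) mpoly ring)"
  by (rule cring_from_type_algebra)

lemma ring_mpoly_ring: "ring (mpoly_ring :: ('v::finite, 'k::field) mpoly ring)"
  by (rule ring_from_type_algebra)

lemma mpoly_idealI:
  fixes I :: "('v::finite, 'k::field) mpoly set"
  assumes "0 \<in> I" "\<And>f g. f \<in> I \<Longrightarrow> g \<in> I \<Longrightarrow> f + g \<in> I" "\<And>f g. g \<in> I \<Longrightarrow> f * g \<in> I"
  shows "ideal I mpoly_ring"
proof (rule idealI)
  interpret ring "mpoly_ring :: ('v, 'k) mpoly ring" by (rule ring_mpoly_ring)
  show "ring (mpoly_ring :: ('v, 'k) mpoly ring)" by (rule ring_mpoly_ring)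
  have inv: "inv\<^bsub>add_monoid mpoly_ring\<^esub> f = - f" for f :: "('v, 'k) mpoly"
    using minus_equality[of "- f" f] by (simp add: a_inv_def)
  have "- f \<in> I" if "f \<in> I" for f
    using assms(3)[OF that, of "- 1"] by simp
  then show "subgroup I (add_monoid mpoly_ring)"
    using assms(1,2) inv unfolding subgroup_def by simp
  show "x \<otimes>\<^bsub>mpoly_ring\<^esub> a \<in> I" "a \<otimes>\<^bsub>mpoly_ring\<^esub> x \<in> I" if "a \<in> I" for a x
    using assms(3)[OF that, of x] by (simp_all add: mult.commute)
qed

lemma mpoly_idealD:
  fixes I :: "('v::finite, 'k::field) mpoly set"
  assumes "ideal I mpoly_ring"
  shows "0 \<in> I" "f \<in> I \<Longrightarrow> g \<in> I \<Longrightarrow> f + g \<in> I" "g \<in> I \<Longrightarrow> f * g \<in> I"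
    "f \<in> I \<Longrightarrow> g \<in> I \<Longrightarrow> f - g \<in> I"
proof -
  interpret ideal I mpoly_ring by (fact assms)
  show "0 \<in> I" using additive_subgroup.zero_closed[OF additive_subgroup_axioms] by simp
  show *: "f \<in> I \<Longrightarrow> g \<in> I \<Longrightarrow> f + g \<in> I" for f g using additive_subgroup.a_closed[OF additive_subgroup_axioms, of f g] by simp
  show **: "g \<in> I \<Longrightarrow> f * g \<in> I" for f g using I_l_closed[of g f] by simp
  show "f \<in> I \<Longrightarrow> g \<in> I \<Longrightarrow> f - g \<in> I" using *[of f "- g"] **[of g "- 1"] by simp
qed

lemma mpoly_ideal_sum:
  fixes I :: "('v::finite, 'k::field) mpoly set"
  assumes "ideal I mpoly_ring" "\<And>x. x \<in> A \<Longrightarrow> f x \<in> I"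
  shows "sum f A \<in> I"
  using assms(2) by (induction A rule: infinite_finite_induct) (auto intro: mpoly_idealD[OF assms(1)])

lemma Idl_is_ideal: "ideal (Idl\<^bsub>mpoly_ring\<^esub> A) (mpoly_ring :: ('v::finite, 'k::field) mpoly ring)"
  by (rule ring.genideal_ideal[OF ring_mpoly_ring]) simp

lemma Idl_self: "A \<subseteq> Idl\<^bsub>mpoly_ring\<^esub> A" for A :: "('v::finite, 'k::field) mpoly set"
  by (rule ring.genideal_self[OF ring_mpoly_ring]) simp

lemma Idl_minimal:
  fixes J :: "('v::finite, 'k::field) mpoly set"
  assumes "ideal J mpoly_ring" "A \<subseteq> J"
  shows "Idl\<^bsub>mpoly_ring\<^esub> A \<subseteq> J"
  by (rule ring.genideal_minimal[OF ring_mpoly_ring assms])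

lemma mvar_mult_in_edge_ideal: "{i, j} \<in> E \<Longrightarrow> mvar i * mvar j \<in> edge_ideal E"
  unfolding edge_ideal_def by (rule subsetD[OF Idl_self]) blast

lemma ideal_edge_ideal: "ideal (edge_ideal E) mpoly_ring"
  unfolding edge_ideal_def by (rule Idl_is_ideal)

lemma keys_add_cases:
  "m \<in> Poly_Mapping.keys (f + g) \<Longrightarrow> m \<in> Poly_Mapping.keys f \<or> m \<in> Poly_Mapping.keys g"
  using keys_add[of f g] by blast

lemma keys_mult_obtain:
  assumes "m \<in> Poly_Mapping.keys (f * g)"
  obtains a b where "a \<in> Poly_Mapping.keys f" "b \<in> Poly_Mapping.keys g" "m = a + b"
  using keys_mult[of f g] assms by blast

text \<open>
  The ideal of the polynomials all of whose monomials have weight at least \<open>d\<close>. For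
  \<open>w = monom_degree\<close> it is the \<open>d\<close>-th power of the maximal graded ideal; if \<open>w\<close> counts the variables
  in a set \<open>C\<close>, it is the \<open>d\<close>-th power of the prime ideal generated by these variables.
\<close>

definition weight_ideal :: "('v monom \<Rightarrow> nat) \<Rightarrow> nat \<Rightarrow> ('v::finite, 'k::field) mpoly set" where
  "weight_ideal w d = {f. \<forall>m\<in>Poly_Mapping.keys f. d \<le> w m}"

lemma weight_idealD: "f \<in> weight_ideal w d \<Longrightarrow> m \<in> Poly_Mapping.keys f \<Longrightarrow> d \<le> w m"
  by (simp add: weight_ideal_def)

locale additive_weight =
  fixes w :: "'v::finite monom \<Rightarrow> nat"
  assumes weight_add: "w (m + m') = w m + w m'"
begin

lemma weight_ideal_mult: "f \<in> weight_ideal w d \<Longrightarrow> g \<in> weight_ideal w d' \<Longrightarrow> f * g \<in> weight_ideal w (d + d')"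
  unfolding weight_ideal_def by (auto elim!: keys_mult_obtain simp: weight_add intro!: add_mono)

lemma weight_ideal_add: "f \<in> weight_ideal w d \<Longrightarrow> g \<in> weight_ideal w d \<Longrightarrow> f + g \<in> weight_ideal w d"
  unfolding weight_ideal_def by (auto dest!: keys_add_cases)

lemma ideal_weight_ideal: "ideal (weight_ideal w d) mpoly_ring"
proof (rule mpoly_idealI)
  show "f * g \<in> weight_ideal w d" if "g \<in> weight_ideal w d" for f g :: "('v, 'k::field) mpoly"
    using weight_ideal_mult[of f 0 g d] that by (simp add: weight_ideal_def)
qed (auto simp: weight_ideal_add, auto simp: weight_ideal_def)

end

lemma monom_degree_weight: "additive_weight monom_degree"
  by unfold_locales (rule monom_degree_add)

lemma ideal_power_0: "ideal_power I 0 = UNIV"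
  by (simp add: ideal_power_def ideals_set_def nat_pow_def)

lemma ideal_power_Suc:
  "ideal_power I (Suc k) = ideal_prod mpoly_ring (ideal_power I k) I"
  by (simp add: ideal_power_def ideals_set_def nat_pow_def)

lemma ideal_ideal_power:
  assumes "ideal I (mpoly_ring :: ('v::finite, 'k::field) mpoly ring)"
  shows "ideal (ideal_power I k) mpoly_ring"
proof -
  interpret cring "mpoly_ring :: ('v, 'k) mpoly ring" by (rule cring_mpoly_ring)
  show ?thesis
    by (induction k) (use assms in \<open>auto simp: ideal_power_0 ideal_power_Suc
        intro!: ideal_prod_is_ideal mpoly_idealI\<close>)
qed

lemma mult_in_ideal_power_Suc:
  "f \<in> ideal_power I k \<Longrightarrow> g \<in> I \<Longrightarrow> f * g \<in> ideal_power I (Suc k)"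
  using ideal_prod.prod[of f "ideal_power I k" g I mpoly_ring] by (simp add: ideal_power_Suc)

lemma power_in_ideal_power: "f \<in> I \<Longrightarrow> f ^ k \<in> ideal_power I k"
proof (induction k)
  case (Suc k)
  then show ?case
    using mult_in_ideal_power_Suc[of "f ^ k" I k f] by (simp add: mult.commute)
qed (simp add: ideal_power_0)

lemma (in additive_weight) ideal_power_weight:
  fixes I :: "('v, 'k::field) mpoly set"
  assumes "I \<subseteq> weight_ideal w d"
  shows "ideal_power I k \<subseteq> weight_ideal w (d * k)"
proof (induction k)
  case 0
  then show ?case by (simp add: weight_ideal_def)
next
  case (Suc k)
  show ?case
  proof
    fix s assume "s \<in> ideal_power I (Suc k)"
    then have "s \<in> ideal_prod mpoly_ring (ideal_power I k) I" by (simp add: ideal_power_Suc)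
    then show "s \<in> weight_ideal w (d * Suc k)"
    proof (induction rule: ideal_prod.induct)
      case (prod i j)
      then have "i * j \<in> weight_ideal w (d * k + d)"
        using Suc assms by (intro weight_ideal_mult) auto
      then show ?case by (simp add: add.commute)
    qed (simp add: weight_ideal_add)
  qed
qed

section \<open>Prime ideals generated by variables\<close>

text \<open>
  The index type of the variables carries no order. Numbering the variables embeds the monomials
  additively into \<open>nat \<Rightarrow>\<^sub>0 nat\<close>, which has a linear order compatible with addition.
\<close>

definition nat_monom :: "'v::finite monom \<Rightarrow> nat \<Rightarrow>\<^sub>0 nat" where
  "nat_monom m = (\<Sum>v\<in>UNIV. Poly_Mapping.single (to_nat v) (Poly_Mapping.lookup m v))"

lemma nat_monom_add: "nat_monom (m + m') = nat_monom m + nat_monom m'"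
  by (simp add: nat_monom_def lookup_add single_add sum.distrib)

lemma lookup_nat_monom: "Poly_Mapping.lookup (nat_monom m) (to_nat v) = Poly_Mapping.lookup m v"
  by (simp add: nat_monom_def lookup_sum lookup_single when_def)

lemma nat_monom_inject: "nat_monom m = nat_monom m' \<longleftrightarrow> m = m'"
  by (metis lookup_nat_monom poly_mapping_eqI)

lemma Max_weight_exists:
  fixes A :: "'v::finite monom set"
  assumes "finite A" "A \<noteq> {}"
  obtains a where "a \<in> A" "\<And>x. x \<in> A \<Longrightarrow> nat_monom x \<le> nat_monom a"
proof -
  have "Max (nat_monom ` A) \<in> nat_monom ` A" using assms by (intro Max_in) auto
  then show ?thesis using assms that by (metis (no_types, lifting) Max_ge finite_imageI image_iff)
qed

text \<open>
  The classical argument for integral domains: among the monomials of weight \<open>0\<close>, the product of the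
  largest one of \<open>f\<close> and the largest one of \<open>g\<close> cannot cancel in \<open>f * g\<close>.
\<close>

lemma (in additive_weight) weight_ideal_1_prime:
  fixes f g :: "('v, 'k::field) mpoly"
  assumes "f * g \<in> weight_ideal w 1" "f \<notin> weight_ideal w 1"
  shows "g \<in> weight_ideal w 1"
proof (rule ccontr)
  assume g: "g \<notin> weight_ideal w 1"
  define A where "A = {m \<in> Poly_Mapping.keys f. w m = 0}"
  define B where "B = {m \<in> Poly_Mapping.keys g. w m = 0}"
  have "A \<noteq> {}" using assms(2) by (auto simp: weight_ideal_def A_def not_le)
  then obtain a where a: "a \<in> A" "\<And>x. x \<in> A \<Longrightarrow> nat_monom x \<le> nat_monom a"
    using Max_weight_exists[of A] by (auto simp: A_def)
  have "B \<noteq> {}" using g by (auto simp: weight_ideal_def B_def not_le)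
  then obtain b where b: "b \<in> B" "\<And>x. x \<in> B \<Longrightarrow> nat_monom x \<le> nat_monom b"
    using Max_weight_exists[of B] by (auto simp: B_def)
  have unique: "l = a \<and> q = b" if "l \<in> Poly_Mapping.keys f" "q \<in> Poly_Mapping.keys g" "a + b = l + q" for l q
  proof -
    have "w l + w q = w a + w b" using that(3) by (metis weight_add)
    then have "w l = 0" "w q = 0" using a b by (auto simp: A_def B_def)
    then have lq: "nat_monom l \<le> nat_monom a" "nat_monom q \<le> nat_monom b"
      using that a b by (auto simp: A_def B_def)
    have eq: "nat_monom l + nat_monom q = nat_monom a + nat_monom b"
      using that(3) by (metis nat_monom_add)
    have "nat_monom l = nat_monom a"
    proof (rule ccontr)
      assume "nat_monom l \<noteq> nat_monom a"
      then have "nat_monom l + nat_monom q < nat_monom a + nat_monom b"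
        using lq by (intro add_less_le_mono) auto
      then show False using eq by simp
    qed
    then show ?thesis using eq by (simp add: nat_monom_inject)
  qed
  have "Poly_Mapping.lookup (f * g) (a + b) =
      (\<Sum>l. Poly_Mapping.lookup f l * (\<Sum>q. Poly_Mapping.lookup g q when a + b = l + q))"
    by (simp add: lookup_mult)
  also have "\<dots> = (\<Sum>l. (Poly_Mapping.lookup f a * Poly_Mapping.lookup g b) when l = a)"
  proof (intro arg_cong[where f = Sum_any] ext)
    fix l
    have "(\<Sum>q. Poly_Mapping.lookup g q when a + b = l + q) = (Poly_Mapping.lookup g b when l = a)"
      if l: "l \<in> Poly_Mapping.keys f"
    proof -
      have "(\<Sum>q. Poly_Mapping.lookup g q when a + b = l + q) =
          (\<Sum>q. (Poly_Mapping.lookup g b when l = a) when q = b)"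
        using unique[OF l] by (intro arg_cong[where f = Sum_any] ext) (auto simp: when_def in_keys_iff)
      then show ?thesis by simp
    qed
    then show "Poly_Mapping.lookup f l * (\<Sum>q. Poly_Mapping.lookup g q when a + b = l + q) =
        (Poly_Mapping.lookup f a * Poly_Mapping.lookup g b when l = a)"
      using a by (cases "l \<in> Poly_Mapping.keys f") (auto simp: when_def in_keys_iff A_def)
  qed
  also have "\<dots> \<noteq> 0" using a b by (simp add: A_def B_def in_keys_iff)
  finally have "a + b \<in> Poly_Mapping.keys (f * g)" by (simp add: in_keys_iff)
  then have "1 \<le> w (a + b)" using assms(1) by (rule weight_idealD[rotated])
  then show False using a b by (simp add: weight_add A_def B_def)
qed

lemma (in additive_weight) primeideal_weight_ideal_1:
  "primeideal (weight_ideal w 1 :: ('v, 'k::field) mpoly set) mpoly_ring"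
proof (rule primeidealI)
  have "w 0 = 0" using weight_add[of 0 0] by simp
  then have "(1 :: ('v, 'k) mpoly) \<notin> weight_ideal w 1" by (simp add: weight_ideal_def)
  then show "carrier mpoly_ring \<noteq> (weight_ideal w 1 :: ('v, 'k) mpoly set)" by auto
  show "a \<in> weight_ideal w 1 \<or> b \<in> weight_ideal w 1"
    if "a \<otimes>\<^bsub>mpoly_ring\<^esub> b \<in> weight_ideal w 1" for a b :: "('v, 'k) mpoly"
    using that weight_ideal_1_prime by auto
qed (rule ideal_weight_ideal cring_mpoly_ring)+

section \<open>Simplicial vertices\<close>

text \<open>
  The neighbours of \<open>y\<close> in \<open>U\<close> form a clique of the graph with adjacency relation \<open>H\<close>.
\<close>

definition simplicial_in :: "('a \<Rightarrow> 'a \<Rightarrow> bool) \<Rightarrow> 'a set \<Rightarrow> 'a \<Rightarrow> bool" where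
  "simplicial_in H U y \<longleftrightarrow> (\<forall>u\<in>U. \<forall>v\<in>U. H y u \<longrightarrow> H y v \<longrightarrow> u \<noteq> v \<longrightarrow> H u v)"

text \<open>
  The vertices \<open>a\<close> and \<open>b\<close> lie in different components of the graph that \<open>H\<close> induces on \<open>W\<close>, with the
  edge \<open>ab\<close> removed: \<open>B\<close> is the indicator function of a union of components.
\<close>

definition edge_separated :: "('a \<Rightarrow> 'a \<Rightarrow> bool) \<Rightarrow> 'a set \<Rightarrow> 'a \<Rightarrow> 'a \<Rightarrow> bool" where
  "edge_separated H W a b \<longleftrightarrow>
     (\<exists>B :: 'a \<Rightarrow> bool. B a \<noteq> B b \<and>
        (\<forall>u\<in>W. \<forall>v\<in>W. H u v \<longrightarrow> {u, v} \<noteq> {a, b} \<longrightarrow> B u = B v))"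

text \<open>
  A form of chordality. A shortest path in \<open>W\<close> from \<open>a\<close> to \<open>b\<close> that avoids the edge \<open>ab\<close> would close up
  with this edge to a chordless cycle, of length at least \<open>4\<close> if no vertex of \<open>W\<close> is adjacent to
  both \<open>a\<close> and \<open>b\<close>; conversely, an edge of such a cycle violates the condition for the vertex set \<open>W\<close>
  of the cycle.
\<close>

definition cut_chordal :: "('a \<Rightarrow> 'a \<Rightarrow> bool) \<Rightarrow> bool" where
  "cut_chordal H \<longleftrightarrow> (\<forall>W a b. a \<in> W \<longrightarrow> b \<in> W \<longrightarrow> H a b \<longrightarrow>
      (\<forall>w\<in>W. \<not> (H w a \<and> H w b)) \<longrightarrow> edge_separated H W a b)"

lemma cut_chordalD:
  assumes "cut_chordal H" "a \<in> W" "b \<in> W" "H a b" "\<And>w. w \<in> W \<Longrightarrow> \<not> (H w a \<and> H w b)"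
  shows "edge_separated H W a b"
  using assms unfolding cut_chordal_def by (elim allE impE) auto

text \<open>
  If the clique \<open>S\<close> contains all neighbours of the part \<open>D\<close> outside \<open>D\<close>, then one of two nonadjacent
  simplicial vertices of \<open>D \<union> S\<close> lies in \<open>D\<close> and remains simplicial in the whole graph. If
  \<open>D \<union> S\<close> is a clique, every vertex of \<open>D\<close> will do.
\<close>

lemma simplicial_vertex_of_part:
  assumes "\<And>u v. H u v \<Longrightarrow> H v u"
    and clique: "\<And>u v. u \<in> S \<Longrightarrow> v \<in> S \<Longrightarrow> u \<noteq> v \<Longrightarrow> H u v"
    and disj: "D \<inter> S = {}" and d: "d \<in> D" and sub: "D \<union> S \<subseteq> U"
    and nbrs: "\<And>u v. u \<in> D \<Longrightarrow> v \<in> U \<Longrightarrow> H u v \<Longrightarrow> v \<in> D \<union> S"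
    and IH: "(\<forall>x\<in>D \<union> S. \<forall>y\<in>D \<union> S. x \<noteq> y \<longrightarrow> H x y) \<or>
      (\<exists>y\<in>D \<union> S. \<exists>y'\<in>D \<union> S. y \<noteq> y' \<and> \<not> H y y' \<and>
         simplicial_in H (D \<union> S) y \<and> simplicial_in H (D \<union> S) y')"
  shows "\<exists>y\<in>D. simplicial_in H U y"
proof -
  have "\<exists>y\<in>D. simplicial_in H (D \<union> S) y"
    using IH
  proof
    assume "\<forall>x\<in>D \<union> S. \<forall>y\<in>D \<union> S. x \<noteq> y \<longrightarrow> H x y"
    then show ?thesis
      using d unfolding simplicial_in_def by blast
  next
    assume "\<exists>y\<in>D \<union> S. \<exists>y'\<in>D \<union> S. y \<noteq> y' \<and> \<not> H y y' \<and>
         simplicial_in H (D \<union> S) y \<and> simplicial_in H (D \<union> S) y'"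
    then show ?thesis
      using clique by blast
  qed
  then show ?thesis
    using nbrs unfolding simplicial_in_def by blast
qed

text \<open>
  Dirac's theorem. For nonadjacent \<open>x\<close> and \<open>z\<close>, let \<open>C\<close> be the component of \<open>z\<close> in the graph without
  \<open>x\<close> and its neighbours, and let \<open>S\<close> be the set of vertices outside \<open>C\<close> with a neighbour in \<open>C\<close>. All of
  \<open>S\<close> is adjacent to \<open>x\<close>, and chordality makes \<open>S\<close> a clique. It separates \<open>C\<close> from the rest \<open>D\<close>, and
  induction yields a simplicial vertex in both \<open>C\<close> and \<open>D\<close>.
\<close>

lemma clique_or_two_simplicial:
  fixes H :: "'a \<Rightarrow> 'a \<Rightarrow> bool"
  assumes sym: "\<And>u v. H u v \<Longrightarrow> H v u" and irrefl: "\<And>u. \<not> H u u"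
    and cut_chordal: "cut_chordal H" and fin: "finite U"
  shows "(\<forall>x\<in>U. \<forall>y\<in>U. x \<noteq> y \<longrightarrow> H x y) \<or>
      (\<exists>y\<in>U. \<exists>y'\<in>U. y \<noteq> y' \<and> \<not> H y y' \<and> simplicial_in H U y \<and> simplicial_in H U y')"
  using fin
proof (induction U rule: finite_psubset_induct)
  case (psubset U)
  show ?case
  proof (cases "\<forall>x\<in>U. \<forall>y\<in>U. x \<noteq> y \<longrightarrow> H x y")
    case False
    then obtain x z where xz: "x \<in> U" "z \<in> U" "x \<noteq> z" "\<not> H x z" by blast
    define N where "N = {v \<in> U. v \<noteq> x \<and> \<not> H x v}"
    define R where "R = {(u, v). u \<in> N \<and> v \<in> N \<and> H u v}"
    define C where "C = R\<^sup>* `` {z}"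
    define S where "S = {s \<in> U. s \<notin> C \<and> (\<exists>c\<in>C. H s c)}"
    have zN: "z \<in> N" using xz by (auto simp: N_def)
    have CN: "C \<subseteq> N"
    proof
      fix c assume "c \<in> C"
      then have "(z, c) \<in> R\<^sup>*" by (simp add: C_def)
      then show "c \<in> N" by (induction rule: rtrancl_induct) (use zN in \<open>auto simp: R_def\<close>)
    qed
    have zC: "z \<in> C" by (simp add: C_def)
    have CU: "C \<subseteq> U" using CN by (auto simp: N_def)
    have xC: "x \<notin> C" using CN by (auto simp: N_def)
    have Sx: "H x s" if "s \<in> S" for s
    proof (rule ccontr)
      assume "\<not> H x s"
      from that obtain c where c: "s \<in> U" "s \<notin> C" "c \<in> C" "H s c" by (auto simp: S_def)
      have "s \<noteq> x" using c CN sym by (auto simp: N_def)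
      then have "s \<in> N" using c \<open>\<not> H x s\<close> by (auto simp: N_def)
      then have "(c, s) \<in> R" using c CN sym by (auto simp: R_def)
      then have "s \<in> C" using c by (auto simp: C_def intro: rtrancl_into_rtrancl)
      then show False using c by blast
    qed
    have clique: "H u v" if uv: "u \<in> S" "v \<in> S" "u \<noteq> v" for u v
    proof (rule ccontr)
      assume nH: "\<not> H u v"
      \<comment> \<open>The edge \<open>xu\<close> is bypassed by the walk from \<open>x\<close> to \<open>v\<close> and through \<open>C\<close> to \<open>u\<close>.\<close>
      let ?W = "C \<union> {x, u, v}"
      have no_common: "\<not> (H w x \<and> H w u)" if "w \<in> ?W" for w
        using that CN nH irrefl sym by (auto simp: N_def)
      have "edge_separated H ?W x u"
        by (rule cut_chordalD[OF cut_chordal]) (use Sx[OF uv(1)] no_common in auto)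
      then obtain B :: "'a \<Rightarrow> bool" where Bxu: "B x \<noteq> B u"
        and B_edge: "\<forall>p\<in>?W. \<forall>q\<in>?W. H p q \<longrightarrow> {p, q} \<noteq> {x, u} \<longrightarrow> B p = B q"
        unfolding edge_separated_def by (elim exE conjE) (rule that)
      have B: "B x \<noteq> B u"
        "\<And>p q. p \<in> ?W \<Longrightarrow> q \<in> ?W \<Longrightarrow> H p q \<Longrightarrow> {p, q} \<noteq> {x, u} \<Longrightarrow> B p = B q"
        using Bxu B_edge by metis+
      have BC: "B c = B z" if "c \<in> C" for c
      proof -
        have "(z, c) \<in> R\<^sup>*" using that by (simp add: C_def)
        then show ?thesis
        proof (induction rule: rtrancl_induct)
          case (step p q)
          have "p \<in> C" "q \<in> C" using step by (auto simp: C_def intro: rtrancl_into_rtrancl)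
          moreover have "H p q" using step by (auto simp: R_def)
          moreover have "{p, q} \<noteq> {x, u}" using \<open>p \<in> C\<close> \<open>q \<in> C\<close> xC by auto
          ultimately have "B p = B q" using B(2) by blast
          then show ?case using step by simp
        qed simp
      qed
      obtain c where c: "c \<in> C" "H u c" using uv by (auto simp: S_def)
      obtain c' where c': "c' \<in> C" "H v c'" using uv by (auto simp: S_def)
      have "x \<noteq> v" using Sx[OF uv(2)] irrefl by metis
      have "B u = B c" using B(2)[of u c] c xC by (fastforce simp: doubleton_eq_iff)
      moreover have "B v = B c'" using B(2)[of v c'] c' xC \<open>x \<noteq> v\<close> by (fastforce simp: doubleton_eq_iff)
      moreover have "B x = B v"
        using B(2)[of x v] Sx[OF uv(2)] uv(3) \<open>x \<noteq> v\<close> by (auto simp: doubleton_eq_iff)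
      ultimately show False using B(1) BC c c' by metis
    qed
    define D where "D = U - (C \<union> S)"
    have xD: "x \<in> D" using xz xC Sx irrefl by (auto simp: D_def)
    have SU: "S \<subseteq> U" by (auto simp: S_def)
    have "\<exists>y\<in>C. simplicial_in H U y"
    proof (rule simplicial_vertex_of_part[of H S C z])
      show "C \<inter> S = {}" by (auto simp: S_def)
      show "\<And>u v. u \<in> C \<Longrightarrow> v \<in> U \<Longrightarrow> H u v \<Longrightarrow> v \<in> C \<union> S"
        using sym by (auto simp: S_def)
      have "C \<union> S \<subset> U" using CU SU xD by (auto simp: D_def)
      then show "(\<forall>x\<in>C \<union> S. \<forall>y\<in>C \<union> S. x \<noteq> y \<longrightarrow> H x y) \<or>
        (\<exists>y\<in>C \<union> S. \<exists>y'\<in>C \<union> S. y \<noteq> y' \<and> \<not> H y y' \<and>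
         simplicial_in H (C \<union> S) y \<and> simplicial_in H (C \<union> S) y')"
        by (rule psubset.IH)
    qed (use sym clique zC CU SU in auto)
    moreover have "\<exists>y\<in>D. simplicial_in H U y"
    proof (rule simplicial_vertex_of_part[of H S D x])
      show "D \<inter> S = {}" by (auto simp: D_def)
      show "\<And>u v. u \<in> D \<Longrightarrow> v \<in> U \<Longrightarrow> H u v \<Longrightarrow> v \<in> D \<union> S"
        by (auto simp: S_def D_def)
      have "z \<notin> D \<union> S" using zC by (auto simp: D_def S_def)
      then have "D \<union> S \<subset> U" using SU xz by (auto simp: D_def)
      then show "(\<forall>x\<in>D \<union> S. \<forall>y\<in>D \<union> S. x \<noteq> y \<longrightarrow> H x y) \<or>
        (\<exists>y\<in>D \<union> S. \<exists>y'\<in>D \<union> S. y \<noteq> y' \<and> \<not> H y y' \<and>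
         simplicial_in H (D \<union> S) y \<and> simplicial_in H (D \<union> S) y')"
        by (rule psubset.IH)
    qed (use sym clique xD SU in \<open>auto simp: D_def\<close>)
    moreover have "\<not> H y y'" "y \<noteq> y'" if "y \<in> C" "y' \<in> D" for y y'
      using that sym CU by (auto simp: D_def S_def)
    ultimately show ?thesis using CU unfolding D_def by blast
  qed blast
qed

section \<open>The Koszul complex of the variables\<close>

lemma antisymmetric_sum_eq_0:
  fixes g :: "'a \<Rightarrow> 'a \<Rightarrow> 'b::ab_group_add"
  assumes "finite A" "\<And>v w. g v w = - g w v" "\<And>v. g v v = 0"
  shows "(\<Sum>v\<in>A. \<Sum>w\<in>A. g v w) = 0"
  using assms(1)
proof (induction A)
  case (insert a A)
  have "(\<Sum>v\<in>A. g v a) = - (\<Sum>w\<in>A. g a w)"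
    by (subst assms(2)) (simp add: sum_negf)
  then show ?case
    using insert assms(3) by (simp add: sum.distrib)
qed simp

text \<open>
  The sign \<open>\<pm>1\<close> with \<open>e\<^sub>v \<and> e\<^sub>\<sigma> = \<pm> e\<close>, where \<open>e\<close> is the basis element of \<open>insert v \<sigma>\<close>, for \<open>v \<notin> \<sigma>\<close>.
  The order of the variables is given by their numbering \<open>to_nat\<close>.
\<close>

definition koszul_sign :: "'v::finite \<Rightarrow> 'v set \<Rightarrow> 'a::comm_ring_1" where
  "koszul_sign v \<sigma> = (- 1) ^ card {u \<in> \<sigma>. to_nat u < to_nat v}"

lemma koszul_sign_square [simp]: "koszul_sign v \<sigma> * koszul_sign v \<sigma> = (1 :: 'a::comm_ring_1)"
  by (simp add: koszul_sign_def flip: power_add mult_2)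

lemma koszul_sign_square' [simp]: "koszul_sign v \<sigma> * (koszul_sign v \<sigma> * x) = (x :: 'a::comm_ring_1)"
  by (simp flip: mult.assoc)

lemma koszul_sign_insert:
  assumes "w \<notin> \<sigma>"
  shows "koszul_sign v (insert w \<sigma>) =
    (if to_nat w < to_nat v then - koszul_sign v \<sigma> else koszul_sign v \<sigma> :: 'a::comm_ring_1)"
proof -
  have "{u \<in> insert w \<sigma>. to_nat u < to_nat v} =
      (if to_nat w < to_nat v then insert w {u \<in> \<sigma>. to_nat u < to_nat v} else {u \<in> \<sigma>. to_nat u < to_nat v})"
    by auto
  then show ?thesis
    using assms by (simp add: koszul_sign_def)
qed

lemma koszul_sign_swap:
  assumes "v \<noteq> w" "v \<notin> \<sigma>" "w \<notin> \<sigma>"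
  shows "koszul_sign w \<sigma> * koszul_sign v (insert w \<sigma>) =
    - (koszul_sign v \<sigma> * koszul_sign w (insert v \<sigma>) :: 'a::comm_ring_1)"
proof -
  have "to_nat v \<noteq> to_nat w" using assms(1) by (simp add: inj_eq)
  then show ?thesis
    using assms by (cases "to_nat v < to_nat w") (simp_all add: koszul_sign_insert mult.commute)
qed

lemma lookup_koszul_sign_times:
  fixes f :: "('v::finite, 'k::field) mpoly"
  shows "Poly_Mapping.lookup (koszul_sign v \<sigma> * f) m = koszul_sign v \<sigma> * Poly_Mapping.lookup f m"
proof -
  have "Poly_Mapping.lookup ((- 1) ^ n * f) m = (- 1) ^ n * Poly_Mapping.lookup f m" for n
    by (induction n) (simp_all add: mult.assoc)
  then show ?thesis by (simp add: koszul_sign_def)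
qed

text \<open>
  A Koszul chain \<open>\<Sum>\<^sub>\<sigma> c\<^sub>\<sigma> e\<^sub>\<sigma>\<close>, in general with components of all homological degrees, is the function
  \<open>\<sigma> \<mapsto> c\<^sub>\<sigma>\<close> on sets of variables; \<open>koszul_diff\<close> is the differential. Koszul chains
  with coefficients in a free module are treated coordinatewise.
\<close>

definition koszul_diff :: "('v set \<Rightarrow> ('v::finite, 'k::field) mpoly) \<Rightarrow> 'v set \<Rightarrow> ('v, 'k) mpoly" where
  "koszul_diff c \<tau> = (\<Sum>v\<in>- \<tau>. koszul_sign v \<tau> * mvar v * c (insert v \<tau>))"

lemma koszul_diff_add: "koszul_diff (\<lambda>\<sigma>. c \<sigma> + c' \<sigma>) \<tau> = koszul_diff c \<tau> + koszul_diff c' \<tau>"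
  by (simp add: koszul_diff_def algebra_simps sum.distrib)

lemma koszul_diff_diff: "koszul_diff (\<lambda>\<sigma>. c \<sigma> - c' \<sigma>) \<tau> = koszul_diff c \<tau> - koszul_diff c' \<tau>"
  by (simp add: koszul_diff_def algebra_simps sum_subtractf)

lemma koszul_diff_zero [simp]: "koszul_diff (\<lambda>\<sigma>. 0) \<tau> = 0"
  by (simp add: koszul_diff_def)

lemma koszul_diff_scale: "koszul_diff (\<lambda>\<sigma>. f * c \<sigma>) \<tau> = f * koszul_diff c \<tau>"
  by (simp add: koszul_diff_def sum_distrib_left mult_ac)

lemma koszul_diff_sum: "koszul_diff (\<lambda>\<sigma>. \<Sum>x\<in>A. c x \<sigma>) \<tau> = (\<Sum>x\<in>A. koszul_diff (c x) \<tau>)"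
  by (induction A rule: infinite_finite_induct) (simp_all add: koszul_diff_add)

lemma koszul_diff_koszul_diff: "koszul_diff (koszul_diff c) \<tau> = 0"
proof -
  define g where "g v w = (if v \<in> \<tau> \<or> w \<in> \<tau> \<or> v = w then 0 else
    koszul_sign v \<tau> * koszul_sign w (insert v \<tau>) * (mvar v * mvar w * c (insert v (insert w \<tau>))))" for v w
  have inner: "koszul_sign v \<tau> * mvar v * koszul_diff c (insert v \<tau>) = (\<Sum>w\<in>- \<tau>. g v w)"
    if "v \<notin> \<tau>" for v
  proof -
    have "koszul_sign v \<tau> * mvar v * koszul_diff c (insert v \<tau>) = (\<Sum>w\<in>- \<tau> - {v}. g v w)"
      unfolding koszul_diff_def sum_distrib_left
      using that by (intro sum.cong) (auto simp: g_def mult_ac insert_commute)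
    also have "\<dots> = (\<Sum>w\<in>- \<tau>. g v w)"
      by (rule sum.mono_neutral_left) (auto simp: g_def)
    finally show ?thesis .
  qed
  have anti: "g v w = - g w v" for v w
  proof (cases "v \<in> \<tau> \<or> w \<in> \<tau> \<or> v = w")
    case False
    then have "v \<notin> \<tau>" "w \<notin> \<tau>" "v \<noteq> w" "w \<noteq> v" by auto
    then show ?thesis
      using koszul_sign_swap[of w v \<tau>, where 'a = "('a, 'b) mpoly"]
      by (simp add: g_def insert_commute mult.commute[of "mvar v" "mvar w"])
  qed (auto simp: g_def)
  have "koszul_diff (koszul_diff c) \<tau> = (\<Sum>v\<in>- \<tau>. \<Sum>w\<in>- \<tau>. g v w)"
    by (subst (1) koszul_diff_def) (simp add: inner)
  also have "\<dots> = 0"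
    by (rule antisymmetric_sum_eq_0) (simp, rule anti, simp add: g_def)
  finally show ?thesis .
qed

text \<open>
  The quotient of the division of a polynomial by the variable \<open>x\<^sub>v\<close>.
\<close>

definition var_quot :: "'v \<Rightarrow> ('v::finite, 'k::field) mpoly \<Rightarrow> ('v, 'k) mpoly" where
  "var_quot v = Poly_Mapping.map_key ((+) (Poly_Mapping.single v 1))"

lemma lookup_var_quot:
  "Poly_Mapping.lookup (var_quot v f) m = Poly_Mapping.lookup f (Poly_Mapping.single v 1 + m)"
  by (simp add: var_quot_def map_key.rep_eq)

lemma var_quot_add: "var_quot v (f + g) = var_quot v f + var_quot v g"
  by (intro poly_mapping_eqI) (simp add: lookup_var_quot lookup_add)

lemma var_quot_zero [simp]: "var_quot v 0 = 0"
  by (intro poly_mapping_eqI) (simp add: lookup_var_quot)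

lemma var_quot_sum: "var_quot v (\<Sum>x\<in>A. f x) = (\<Sum>x\<in>A. var_quot v (f x))"
  by (induction A rule: infinite_finite_induct) (simp_all add: var_quot_add)

lemma var_quot_sign: "var_quot v (koszul_sign u \<sigma> * f) = koszul_sign u \<sigma> * var_quot v f"
  by (intro poly_mapping_eqI) (simp add: lookup_var_quot lookup_koszul_sign_times)

lemma var_quot_mvar_same: "var_quot v (mvar v * f) = f"
  by (intro poly_mapping_eqI) (simp add: lookup_var_quot mvar_def lookup_monomial_times del: One_nat_def)

lemma var_quot_mvar:
  fixes f :: "('v::finite, 'k::field) mpoly"
  assumes "v \<noteq> w"
  shows "var_quot v (mvar w * f) = mvar w * var_quot v f"
proof (intro poly_mapping_eqI)
  fix m :: "'v monom"
  have "Poly_Mapping.single v 1 + m - Poly_Mapping.single w 1 =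
      Poly_Mapping.single v 1 + (m - Poly_Mapping.single w 1)" if "Poly_Mapping.lookup m w \<noteq> 0"
    using assms by (intro poly_mapping_eqI)
      (auto simp: lookup_add lookup_minus lookup_single when_def)
  then show "Poly_Mapping.lookup (var_quot v (mvar w * f)) m =
      Poly_Mapping.lookup (mvar w * var_quot v f) m"
    using assms by (simp add: lookup_var_quot lookup_mvar_times lookup_add lookup_single when_def)
qed

lemma keys_minus_var_quot:
  assumes "m \<in> Poly_Mapping.keys (f - mvar v * var_quot v f)"
  shows "m \<in> Poly_Mapping.keys f \<and> Poly_Mapping.lookup m v = 0"
proof -
  have "Poly_Mapping.lookup (mvar v * var_quot v f) m =
      (if Poly_Mapping.lookup m v = 0 then 0 else Poly_Mapping.lookup f m)"
    by (simp add: lookup_mvar_times lookup_var_quot monomial_minus_variable del: One_nat_def)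
  then show ?thesis
    using assms by (auto simp: in_keys_iff lookup_minus split: if_splits)
qed

text \<open>
  The chain \<open>h(z) = e\<^sub>v \<and> var_quot v z\<close> defines a homotopy between the identity and the projection onto
  the chains that involve neither \<open>e\<^sub>v\<close> nor \<open>x\<^sub>v\<close>. Hence every cycle is homologous to its image
  under this projection.
\<close>

lemma koszul_cycle_reduce_variable:
  fixes z :: "'v set \<Rightarrow> ('v::finite, 'k::field) mpoly"
  assumes cycle: "\<And>\<tau>. koszul_diff z \<tau> = 0"
  shows "\<exists>b. \<forall>\<sigma>. z \<sigma> = koszul_diff b \<sigma> +
    (if v \<in> \<sigma> then 0 else z \<sigma> - mvar v * var_quot v (z \<sigma>))"
proof -
  define h where
    "h \<sigma> = (if v \<in> \<sigma> then koszul_sign v (\<sigma> - {v}) * var_quot v (z (\<sigma> - {v})) else 0)" for \<sigma>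
  have "z \<sigma> = koszul_diff h \<sigma> + (if v \<in> \<sigma> then 0 else z \<sigma> - mvar v * var_quot v (z \<sigma>))" for \<sigma>
  proof (cases "v \<in> \<sigma>")
    case False
    have "koszul_diff h \<sigma> = (\<Sum>w\<in>- \<sigma>. if w = v then mvar v * var_quot v (z \<sigma>) else 0)"
      unfolding koszul_diff_def using False
      by (intro sum.cong) (auto simp: h_def mult_ac)
    also have "\<dots> = mvar v * var_quot v (z \<sigma>)"
      using False by simp
    finally show ?thesis using False by simp
  next
    case True
    define \<rho> where "\<rho> = \<sigma> - {v}"
    have \<rho>: "\<sigma> = insert v \<rho>" "v \<notin> \<rho>" using True by (auto simp: \<rho>_def)
    define q where "q w = mvar w * var_quot v (z (insert w \<rho>))" for w
    have "0 = var_quot v (koszul_diff z \<rho>)" by (simp add: cycle)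
    also have "\<dots> = (\<Sum>w\<in>- \<rho>. koszul_sign w \<rho> * var_quot v (mvar w * z (insert w \<rho>)))"
      by (simp add: koszul_diff_def var_quot_sum var_quot_sign mult.assoc)
    also have "\<dots> = koszul_sign v \<rho> * z \<sigma> +
        (\<Sum>w\<in>- \<rho> - {v}. koszul_sign w \<rho> * var_quot v (mvar w * z (insert w \<rho>)))"
      using \<rho> by (subst sum.remove[of _ v]) (auto simp: var_quot_mvar_same)
    also have "(\<Sum>w\<in>- \<rho> - {v}. koszul_sign w \<rho> * var_quot v (mvar w * z (insert w \<rho>))) =
        (\<Sum>w\<in>- \<sigma>. koszul_sign w \<rho> * q w)"
      by (intro sum.cong) (auto simp: \<rho> q_def var_quot_mvar)
    finally have "koszul_sign v \<rho> * (koszul_sign v \<rho> * z \<sigma> + (\<Sum>w\<in>- \<sigma>. koszul_sign w \<rho> * q w)) = 0"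
      by simp
    then have z: "z \<sigma> = - (koszul_sign v \<rho> * (\<Sum>w\<in>- \<sigma>. koszul_sign w \<rho> * q w))"
      by (simp add: distrib_left eq_neg_iff_add_eq_0)
    have sign: "koszul_sign w \<sigma> * koszul_sign v (insert w \<rho>) =
        - (koszul_sign v \<rho> * koszul_sign w \<rho> :: ('v, 'k) mpoly)" if "w \<notin> \<sigma>" for w
    proof -
      have "koszul_sign w \<rho> * koszul_sign v (insert w \<rho>) =
        - (koszul_sign v \<rho> * koszul_sign w \<sigma> :: ('v, 'k) mpoly)"
        using koszul_sign_swap[of v w \<rho>] that by (auto simp: \<rho>)
      then have "koszul_sign w \<rho> * (koszul_sign w \<sigma> * (koszul_sign w \<rho> * koszul_sign v (insert w \<rho>))) =
        koszul_sign w \<rho> * (koszul_sign w \<sigma> * - (koszul_sign v \<rho> * koszul_sign w \<sigma> :: ('v, 'k) mpoly))"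
        by (rule arg_cong)
      then show ?thesis by (simp add: mult_ac)
    qed
    have "koszul_diff h \<sigma> = (\<Sum>w\<in>- \<sigma>. (koszul_sign w \<sigma> * koszul_sign v (insert w \<rho>)) * q w)"
      unfolding koszul_diff_def
    proof (intro sum.cong refl)
      fix w assume "w \<in> - \<sigma>"
      then have "insert w \<sigma> - {v} = insert w \<rho>" by (auto simp: \<rho>_def True)
      then show "koszul_sign w \<sigma> * mvar w * h (insert w \<sigma>) =
          koszul_sign w \<sigma> * koszul_sign v (insert w \<rho>) * q w"
        by (simp add: h_def q_def True mult_ac)
    qed
    also have "\<dots> = z \<sigma>"
      unfolding z sum_distrib_left sum_negf[symmetric]
      by (intro sum.cong) (auto simp: sign mult_ac)
    finally show ?thesis using True by simp
  qed
  then show ?thesis by (intro exI[of _ h] allI)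
qed

lemma koszul_cycle_reduce_variables:
  fixes z :: "'v set \<Rightarrow> ('v::finite, 'k::field) mpoly"
  assumes "\<And>\<tau>. koszul_diff z \<tau> = 0" "finite T"
  shows "\<exists>b y. (\<forall>\<sigma>. z \<sigma> = koszul_diff b \<sigma> + y \<sigma>) \<and> (\<forall>\<sigma>. \<sigma> \<inter> T \<noteq> {} \<longrightarrow> y \<sigma> = 0) \<and>
    (\<forall>\<sigma>. \<forall>m\<in>Poly_Mapping.keys (y \<sigma>). m \<in> Poly_Mapping.keys (z \<sigma>) \<and>
       (\<forall>v\<in>T. Poly_Mapping.lookup m v = 0))"
  using assms(2)
proof (induction T)
  case empty
  show ?case by (rule exI[of _ "\<lambda>_. 0"], rule exI[of _ z]) auto
next
  case (insert v T)
  from insert.IH obtain b y where by0: "\<forall>\<sigma>. z \<sigma> = koszul_diff b \<sigma> + y \<sigma>"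
    "\<forall>\<sigma>. \<sigma> \<inter> T \<noteq> {} \<longrightarrow> y \<sigma> = 0"
    "\<forall>\<sigma>. \<forall>m\<in>Poly_Mapping.keys (y \<sigma>). m \<in> Poly_Mapping.keys (z \<sigma>) \<and>
       (\<forall>v\<in>T. Poly_Mapping.lookup m v = 0)"
    by (elim exE conjE)
  have "y = (\<lambda>\<sigma>. z \<sigma> - koszul_diff b \<sigma>)" using by0(1) by (simp add: fun_eq_iff)
  then have "koszul_diff y \<tau> = 0" for \<tau>
    by (simp add: koszul_diff_diff koszul_diff_koszul_diff assms(1))
  then have "\<exists>b'. \<forall>\<sigma>. y \<sigma> = koszul_diff b' \<sigma> +
      (if v \<in> \<sigma> then 0 else y \<sigma> - mvar v * var_quot v (y \<sigma>))"
    by (rule koszul_cycle_reduce_variable)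
  then obtain b' where b': "\<forall>\<sigma>. y \<sigma> = koszul_diff b' \<sigma> +
      (if v \<in> \<sigma> then 0 else y \<sigma> - mvar v * var_quot v (y \<sigma>))"
    by (rule exE)
  define y' where "y' \<sigma> = (if v \<in> \<sigma> then 0 else y \<sigma> - mvar v * var_quot v (y \<sigma>))" for \<sigma>
  have 1: "z \<sigma> = koszul_diff (\<lambda>\<sigma>. b \<sigma> + b' \<sigma>) \<sigma> + y' \<sigma>" for \<sigma>
    using spec[OF by0(1), of \<sigma>] spec[OF b', of \<sigma>] by (simp add: koszul_diff_add y'_def)
  have 2: "y' \<sigma> = 0" if "\<sigma> \<inter> insert v T \<noteq> {}" for \<sigma>
    using that spec[OF by0(2), of \<sigma>] by (auto simp: y'_def)
  have 3: "m \<in> Poly_Mapping.keys (z \<sigma>) \<and> (\<forall>u\<in>insert v T. Poly_Mapping.lookup m u = 0)"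
    if "m \<in> Poly_Mapping.keys (y' \<sigma>)" for m \<sigma>
  proof -
    have "m \<in> Poly_Mapping.keys (y \<sigma> - mvar v * var_quot v (y \<sigma>))"
      using that by (auto simp: y'_def split: if_splits)
    then show ?thesis using keys_minus_var_quot[of m "y \<sigma>" v] bspec[OF spec[OF by0(3), of \<sigma>], of m] by auto
  qed
  show ?case
    by (rule exI[of _ "\<lambda>\<sigma>. b \<sigma> + b' \<sigma>"], rule exI[of _ y'], intro conjI allI impI ballI)
      (rule 1, erule 2, use 3 in auto)
qed

text \<open>
  For total chains, exactness in positive homological degrees and \<open>H\<^sub>0 = S / (x\<^sub>v : v)\<close> amount to a
  single condition on the constant term.
\<close>

lemma koszul_exact:
  fixes z :: "'v set \<Rightarrow> ('v::finite, 'k::field) mpoly"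
  assumes "\<And>\<tau>. koszul_diff z \<tau> = 0" "Poly_Mapping.lookup (z {}) 0 = 0"
  shows "\<exists>b. \<forall>\<sigma>. z \<sigma> = koszul_diff b \<sigma>"
proof -
  obtain b y where b: "\<forall>\<sigma>. z \<sigma> = koszul_diff b \<sigma> + y \<sigma>"
    and y: "\<forall>\<sigma>. \<sigma> \<inter> UNIV \<noteq> {} \<longrightarrow> y \<sigma> = 0"
      "\<forall>\<sigma>. \<forall>m\<in>Poly_Mapping.keys (y \<sigma>). m \<in> Poly_Mapping.keys (z \<sigma>) \<and>
         (\<forall>v\<in>UNIV. Poly_Mapping.lookup m v = 0)"
    using koszul_cycle_reduce_variables[OF assms(1) finite_UNIV] by (elim exE conjE)
  have "y {} = 0"
  proof (rule ccontr)
    assume "y {} \<noteq> 0"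
    then obtain m where m: "m \<in> Poly_Mapping.keys (y {})"
      by (metis equals0I keys_eq_empty)
    then have "m = 0" using y(2) m by (intro poly_mapping_eqI) simp
    then show False using y(2) m assms(2) by (auto simp: in_keys_iff)
  qed
  then have "y \<sigma> = 0" for \<sigma> using spec[OF y(1), of \<sigma>] by (cases "\<sigma> = {}") auto
  then show ?thesis using b by auto
qed

section \<open>Linear resolutions and Koszul cycles\<close>

text \<open>
  The coordinate \<open>a\<close> of the product of a matrix with \<open>r\<close> columns and a vector. Vectors are functions on
  all natural numbers, of which only the values below \<open>r\<close> matter; this makes vectors of different
  lengths elements of one type.
\<close>

definition matrix_apply :: "(nat \<Rightarrow> nat \<Rightarrow> 'a::comm_ring_1) \<Rightarrow> nat \<Rightarrow> (nat \<Rightarrow> 'a) \<Rightarrow> nat \<Rightarrow> 'a" where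
  "matrix_apply A r u a = (\<Sum>b<r. A a b * u b)"

lemma matrix_apply_diff: "matrix_apply A r (\<lambda>b. u b - u' b) a = matrix_apply A r u a - matrix_apply A r u' a"
  by (simp add: matrix_apply_def algebra_simps sum_subtractf)

lemma matrix_apply_cong:
  "(\<And>b. b < r \<Longrightarrow> u b = u' b) \<Longrightarrow> matrix_apply A r u a = matrix_apply A r u' a"
  by (simp add: matrix_apply_def)

lemma koszul_diff_matrix_apply:
  "koszul_diff (\<lambda>\<sigma>. matrix_apply A r (c \<sigma>) a) \<tau> = matrix_apply A r (\<lambda>b. koszul_diff (\<lambda>\<sigma>. c \<sigma> b) \<tau>) a"
  by (simp add: matrix_apply_def koszul_diff_sum koszul_diff_scale)

lemma graded_component_sum:
  assumes "\<And>x. x \<in> A \<Longrightarrow> f x \<in> graded_component d"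
  shows "sum f A \<in> graded_component d"
  using assms
  by (induction A rule: infinite_finite_induct)
    (auto simp: graded_component_def dest!: keys_add_cases)

lemma weight_ideal_1_iff: "f \<in> weight_ideal monom_degree 1 \<longleftrightarrow> Poly_Mapping.lookup f 0 = 0"
proof -
  have "f \<in> weight_ideal monom_degree 1 \<longleftrightarrow> (\<forall>m\<in>Poly_Mapping.keys f. m \<noteq> 0)"
    unfolding weight_ideal_def by (auto simp: Suc_le_eq simp flip: monom_degree_eq_0_iff)
  then show ?thesis by (auto simp: in_keys_iff)
qed

lemma mvar_in_weight_ideal: "mvar v \<in> weight_ideal monom_degree 1"
  by (simp add: mvar_def weight_ideal_def)

interpretation deg: additive_weight monom_degree by (rule monom_degree_weight)

lemma koszul_diff_weight_ideal:
  assumes "\<And>\<sigma>. c \<sigma> \<in> weight_ideal monom_degree d"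
  shows "koszul_diff c \<tau> \<in> weight_ideal monom_degree (Suc d)"
  unfolding koszul_diff_def
proof (rule mpoly_ideal_sum[OF deg.ideal_weight_ideal])
  fix v
  have "koszul_sign v \<tau> * (mvar v * c (insert v \<tau>)) \<in> weight_ideal monom_degree (0 + (1 + d))"
    by (intro deg.weight_ideal_mult mvar_in_weight_ideal assms) (simp add: weight_ideal_def)
  then show "koszul_sign v \<tau> * mvar v * c (insert v \<tau>) \<in> weight_ideal monom_degree (Suc d)"
    by (simp add: mult.assoc)
qed

text \<open>
  The contribution of the constant terms of \<open>u\<close> to the image of \<open>u\<close> is homogeneous of degree \<open>e\<close>. It
  vanishes if the image lives in degrees above \<open>e\<close>, so the constant terms can be dropped.
\<close>

lemma lift_without_constant_term:
  fixes A :: "nat \<Rightarrow> nat \<Rightarrow> ('v::finite, 'k::field) mpoly"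
  assumes A: "\<And>a b. a < r' \<Longrightarrow> b < r \<Longrightarrow> A a b \<in> graded_component e"
    and y: "\<And>a. a < r' \<Longrightarrow> y a \<in> weight_ideal monom_degree (Suc e)"
    and u: "\<And>a. a < r' \<Longrightarrow> y a = matrix_apply A r u a"
  obtains u' where "\<forall>b. u' b \<in> weight_ideal monom_degree 1" "\<forall>a<r'. y a = matrix_apply A r u' a"
proof -
  define c :: "nat \<Rightarrow> ('v, 'k) mpoly" where "c b = Poly_Mapping.single 0 (Poly_Mapping.lookup (u b) 0)" for b
  define u' where "u' b = u b - c b" for b
  have u'1: "u' b \<in> weight_ideal monom_degree 1" for b
    by (simp add: weight_ideal_1_iff u'_def c_def lookup_minus del: One_nat_def)
  have y_eq: "y a = matrix_apply A r u' a" if a: "a < r'" for a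
  proof -
    have "matrix_apply A r c a \<in> graded_component e"
      unfolding matrix_apply_def
    proof (rule graded_component_sum)
      fix b assume "b \<in> {..<r}"
      then have "A a b \<in> graded_component e" using A a by auto
      then show "A a b * c b \<in> graded_component e"
        unfolding graded_component_def c_def
        by (auto elim!: keys_mult_obtain split: if_splits)
    qed
    moreover have "matrix_apply A r u' a \<in> weight_ideal monom_degree (e + 1)"
      unfolding matrix_apply_def
    proof (rule mpoly_ideal_sum[OF deg.ideal_weight_ideal])
      fix b assume "b \<in> {..<r}"
      then have "A a b \<in> graded_component e" using A a by auto
      then have "A a b \<in> weight_ideal monom_degree e"
        by (simp add: graded_component_def weight_ideal_def)
      then show "A a b * u' b \<in> weight_ideal monom_degree (e + 1)"
        using u'1 by (rule deg.weight_ideal_mult)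
    qed
    moreover have eq: "y a - matrix_apply A r u' a = matrix_apply A r c a"
      using u[OF a] matrix_apply_diff[of A r u c a] by (simp add: u'_def[abs_def])
    ultimately have "matrix_apply A r c a \<in> weight_ideal monom_degree (Suc e)"
      using mpoly_idealD(4)[OF deg.ideal_weight_ideal y[OF a], of "matrix_apply A r u' a"] by simp
    with \<open>matrix_apply A r c a \<in> graded_component e\<close> have "Poly_Mapping.keys (matrix_apply A r c a) = {}"
      unfolding graded_component_def weight_ideal_def by fastforce
    then show ?thesis using eq by simp
  qed
  show ?thesis by (rule that[of u']) (intro allI impI u'1 y_eq)+
qed

text \<open>
  Let \<open>A (Suc i)\<close> be matrices of linear forms in an exact sequence of free modules of ranks \<open>r i\<close>, and
  let \<open>c\<close> be a Koszul chain with coefficients in the free module of rank \<open>r (Suc i)\<close>, without constant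
  terms, whose boundary is killed by \<open>A i\<close>. Then \<open>c\<close> is a boundary modulo the image of \<open>A (Suc i)\<close>.
  The boundary of \<open>c\<close> lifts along \<open>A (Suc i)\<close> to a chain that satisfies the same hypotheses for \<open>Suc i\<close>
  and is zero above a smaller homological degree; induction on this degree \<open>n\<close> applies to the lift.
\<close>

lemma koszul_chase:
  fixes A :: "nat \<Rightarrow> nat \<Rightarrow> nat \<Rightarrow> ('v::finite, 'k::field) mpoly" and r :: "nat \<Rightarrow> nat"
  assumes exact: "\<And>i u. (\<forall>a<r i. matrix_apply (A i) (r (Suc i)) u a = 0) \<longleftrightarrow>
      (\<exists>w. \<forall>b<r (Suc i). u b = matrix_apply (A (Suc i)) (r (Suc (Suc i))) w b)"
    and lin: "\<And>i a b. a < r (Suc i) \<Longrightarrow> b < r (Suc (Suc i)) \<Longrightarrow> A (Suc i) a b \<in> graded_component 1"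
    and c: "\<And>\<sigma> b. b < r (Suc i) \<Longrightarrow> c \<sigma> b \<in> weight_ideal monom_degree 1"
    and supp: "\<And>\<sigma> b. n < card \<sigma> \<Longrightarrow> b < r (Suc i) \<Longrightarrow> c \<sigma> b = 0"
    and cyc: "\<And>\<tau> a. a < r i \<Longrightarrow>
      matrix_apply (A i) (r (Suc i)) (\<lambda>b. koszul_diff (\<lambda>\<sigma>. c \<sigma> b) \<tau>) a = 0"
  shows "\<exists>b b'. \<forall>\<sigma>. \<forall>a<r (Suc i). c \<sigma> a =
    koszul_diff (\<lambda>\<sigma>. b \<sigma> a) \<sigma> + matrix_apply (A (Suc i)) (r (Suc (Suc i))) (b' \<sigma>) a"
  using c supp cyc
proof (induction n arbitrary: i c)
  case 0
  \<comment> \<open>Here \<open>c\<close> is concentrated in homological degree \<open>0\<close>, and therefore a cycle.\<close>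
  have "\<exists>b. \<forall>\<sigma>. c \<sigma> a = koszul_diff b \<sigma>" if a: "a < r (Suc i)" for a
  proof (rule koszul_exact)
    have "c (insert v \<tau>) a = 0" for v \<tau>
      using 0(2)[OF _ a, of "insert v \<tau>"] by (simp add: card_gt_0_iff)
    then show "koszul_diff (\<lambda>\<sigma>. c \<sigma> a) \<tau> = 0" for \<tau>
      by (simp add: koszul_diff_def)
    show "Poly_Mapping.lookup (c {} a) 0 = 0"
      using 0(1)[OF a] by (simp add: weight_ideal_1_iff del: One_nat_def)
  qed
  then have "\<forall>a. \<exists>b. a < r (Suc i) \<longrightarrow> (\<forall>\<sigma>. c \<sigma> a = koszul_diff b \<sigma>)" by auto
  from choice[OF this] obtain b where b: "\<forall>a. a < r (Suc i) \<longrightarrow> (\<forall>\<sigma>. c \<sigma> a = koszul_diff (b a) \<sigma>)"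
    by (rule exE)
  show ?case
    by (rule exI[of _ "\<lambda>\<sigma> a. b a \<sigma>"], rule exI[of _ "\<lambda>\<sigma> a. 0"])
      (use b in \<open>simp add: matrix_apply_def\<close>)
next
  case (Suc n)
  \<comment> \<open>The coordinates from \<open>r (Suc i)\<close> on are arbitrary; setting them to \<open>0\<close> avoids side conditions.\<close>
  let ?dc = "\<lambda>\<tau> b. koszul_diff (\<lambda>\<sigma>. if b < r (Suc i) then c \<sigma> b else 0) \<tau>"
  let ?A = "A (Suc i)" and ?r = "r (Suc (Suc i))"
  have dc: "?dc \<tau> b = koszul_diff (\<lambda>\<sigma>. c \<sigma> b) \<tau>" if "b < r (Suc i)" for \<tau> b
    using that by simp
  have "\<exists>u. (\<forall>b. u b \<in> weight_ideal monom_degree 1) \<and> (\<forall>a<r (Suc i). ?dc \<tau> a = matrix_apply ?A ?r u a) \<and>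
      (n < card \<tau> \<longrightarrow> u = (\<lambda>_. 0))" for \<tau>
  proof (cases "n < card \<tau>")
    case True
    have "?dc \<tau> a = 0" if a: "a < r (Suc i)" for a
    proof -
      have "c (insert v \<tau>) a = 0" if "v \<notin> \<tau>" for v
        using Suc.prems(2)[OF _ a, of "insert v \<tau>"] True that by simp
      then show ?thesis using a by (simp add: koszul_diff_def)
    qed
    then show ?thesis by (intro exI[of _ "\<lambda>_. 0"]) (simp add: matrix_apply_def weight_ideal_def)
  next
    case False
    have "matrix_apply (A i) (r (Suc i)) (?dc \<tau>) a =
        matrix_apply (A i) (r (Suc i)) (\<lambda>b. koszul_diff (\<lambda>\<sigma>. c \<sigma> b) \<tau>) a" for a
      by (rule matrix_apply_cong) (rule dc)
    then have "\<forall>a<r i. matrix_apply (A i) (r (Suc i)) (?dc \<tau>) a = 0"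
      using Suc.prems(3) by simp
    then obtain u where u: "\<forall>b<r (Suc i). ?dc \<tau> b = matrix_apply ?A ?r u b"
      unfolding exact by (rule exE)
    obtain u' where "\<forall>b. u' b \<in> weight_ideal monom_degree 1" "\<forall>a<r (Suc i). ?dc \<tau> a = matrix_apply ?A ?r u' a"
    proof (rule lift_without_constant_term[of "r (Suc i)" ?r ?A 1 "?dc \<tau>" u])
      show "?A a b \<in> graded_component 1" if "a < r (Suc i)" "b < ?r" for a b
        using lin that by blast
      show "?dc \<tau> a \<in> weight_ideal monom_degree (Suc 1)" for a
        by (rule koszul_diff_weight_ideal) (use Suc.prems(1) in \<open>auto simp: weight_ideal_def\<close>)
    qed (use u in auto)
    then show ?thesis using False by blast
  qed
  then have "\<forall>\<tau>. \<exists>u. (\<forall>b. u b \<in> weight_ideal monom_degree 1) \<and>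
      (\<forall>a<r (Suc i). ?dc \<tau> a = matrix_apply ?A ?r u a) \<and> (n < card \<tau> \<longrightarrow> u = (\<lambda>_. 0))"
    by (rule allI)
  from choice[OF this] obtain c' where c': "\<forall>\<tau>. (\<forall>b. c' \<tau> b \<in> weight_ideal monom_degree 1) \<and>
      (\<forall>a<r (Suc i). ?dc \<tau> a = matrix_apply ?A ?r (c' \<tau>) a) \<and> (n < card \<tau> \<longrightarrow> c' \<tau> = (\<lambda>_. 0))"
    by (rule exE)
  have c'_lift: "matrix_apply ?A ?r (c' \<tau>) a = koszul_diff (\<lambda>\<sigma>. c \<sigma> a) \<tau>" if "a < r (Suc i)" for \<tau> a
    using c' dc that by metis
  have "\<exists>b b'. \<forall>\<sigma>. \<forall>a<?r. c' \<sigma> a = koszul_diff (\<lambda>\<sigma>. b \<sigma> a) \<sigma> +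
      matrix_apply (A (Suc (Suc i))) (r (Suc (Suc (Suc i)))) (b' \<sigma>) a"
  proof (rule Suc.IH)
    show "c' \<sigma> b \<in> weight_ideal monom_degree 1" for \<sigma> b using c' by blast
    show "c' \<sigma> b = 0" if "n < card \<sigma>" for \<sigma> b using c' that by metis
    show "matrix_apply ?A ?r (\<lambda>b. koszul_diff (\<lambda>\<sigma>. c' \<sigma> b) \<tau>) a = 0" if "a < r (Suc i)" for \<tau> a
      by (simp add: c'_lift that koszul_diff_koszul_diff flip: koszul_diff_matrix_apply)
  qed
  then obtain b b' where b: "\<forall>\<sigma>. \<forall>a<?r. c' \<sigma> a = koszul_diff (\<lambda>\<sigma>. b \<sigma> a) \<sigma> +
      matrix_apply (A (Suc (Suc i))) (r (Suc (Suc (Suc i)))) (b' \<sigma>) a"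
    by (elim exE)
  have "\<exists>d. \<forall>\<sigma>. c \<sigma> a - matrix_apply ?A ?r (b \<sigma>) a = koszul_diff d \<sigma>" if a: "a < r (Suc i)" for a
  proof (rule koszul_exact)
    fix \<tau>
    have "\<forall>q<?r. c' \<tau> q - koszul_diff (\<lambda>\<sigma>. b \<sigma> q) \<tau> =
        matrix_apply (A (Suc (Suc i))) (r (Suc (Suc (Suc i)))) (b' \<tau>) q"
      using b by simp
    then have "matrix_apply ?A ?r (\<lambda>q. c' \<tau> q - koszul_diff (\<lambda>\<sigma>. b \<sigma> q) \<tau>) a = 0"
      using exact[of "Suc i" "\<lambda>q. c' \<tau> q - koszul_diff (\<lambda>\<sigma>. b \<sigma> q) \<tau>"] a by blast
    then show "koszul_diff (\<lambda>\<sigma>. c \<sigma> a - matrix_apply ?A ?r (b \<sigma>) a) \<tau> = 0"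
      by (simp add: koszul_diff_diff koszul_diff_matrix_apply matrix_apply_diff c'_lift a)
  next
    have "?A a q * b {} q \<in> weight_ideal monom_degree (1 + 0)" if "q < ?r" for q
      using lin[OF a that] by (intro deg.weight_ideal_mult) (auto simp: graded_component_def weight_ideal_def)
    then have "matrix_apply ?A ?r (b {}) a \<in> weight_ideal monom_degree 1"
      unfolding matrix_apply_def by (intro mpoly_ideal_sum[OF deg.ideal_weight_ideal]) simp
    then have "c {} a - matrix_apply ?A ?r (b {}) a \<in> weight_ideal monom_degree 1"
      using Suc.prems(1)[OF a] by (intro mpoly_idealD(4)[OF deg.ideal_weight_ideal])
    then show "Poly_Mapping.lookup (c {} a - matrix_apply ?A ?r (b {}) a) 0 = 0"
      by (simp add: weight_ideal_1_iff del: One_nat_def)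
  qed
  then have "\<forall>a. \<exists>d. a < r (Suc i) \<longrightarrow> (\<forall>\<sigma>. c \<sigma> a - matrix_apply ?A ?r (b \<sigma>) a = koszul_diff d \<sigma>)" by auto
  from choice[OF this] obtain d where
    d: "\<forall>a. a < r (Suc i) \<longrightarrow> (\<forall>\<sigma>. c \<sigma> a - matrix_apply ?A ?r (b \<sigma>) a = koszul_diff (d a) \<sigma>)"
    by (rule exE)
  show ?case
    by (rule exI[of _ "\<lambda>\<sigma> a. d a \<sigma>"], rule exI[of _ b]) (use d in \<open>auto simp: algebra_simps\<close>)
qed

lemma mult_mat_vec_index:
  assumes "M \<in> carrier_mat m n" "v \<in> carrier_vec n" "a < m"
  shows "(M *\<^sub>v v) $ a = matrix_apply (\<lambda>a b. M $$ (a, b)) n (\<lambda>b. v $ b) a"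
  using assms by (auto simp: scalar_prod_def matrix_apply_def atLeast0LessThan intro!: sum.cong)

text \<open>
  The free modules of the resolution have ranks \<open>r 1, r 2, \<dots>\<close>; with \<open>r 0 = 1\<close> for \<open>S\<close> itself, the
  augmentation becomes the first map \<open>A 0\<close> of the sequence, and exactness has the same form everywhere
  but at \<open>S\<close>.
\<close>

lemma linear_resolution_cases:
  fixes I :: "('v::finite, 'k::field) mpoly set"
  assumes "has_linear_resolution I"
  obtains d G r and A :: "nat \<Rightarrow> nat \<Rightarrow> nat \<Rightarrow> ('v, 'k) mpoly" where
    "G \<subseteq> graded_component d" "I = Idl\<^bsub>mpoly_ring\<^esub> G" "r 0 = 1"
    "I = range (\<lambda>u. matrix_apply (A 0) (r 1) u 0)"
    "\<forall>i u. (\<forall>a<r i. matrix_apply (A i) (r (Suc i)) u a = 0) \<longleftrightarrow>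
      (\<exists>w. \<forall>b<r (Suc i). u b = matrix_apply (A (Suc i)) (r (Suc (Suc i))) w b)"
    "\<forall>b<r 1. A 0 0 b \<in> graded_component d"
    "\<forall>i. \<forall>a<r (Suc i). \<forall>b<r (Suc (Suc i)). A (Suc i) a b \<in> graded_component 1"
proof -
  obtain d \<beta> G where G: "G \<subseteq> graded_component d" "I = Idl\<^bsub>mpoly_ring\<^esub> G"
    and \<beta>: "graded_betti_numbers I \<beta>" and lin: "\<forall>i j. j \<noteq> i + d \<longrightarrow> \<beta> i j = 0"
    using assms unfolding has_linear_resolution_def by (elim exE conjE)
  obtain s \<phi> where res: "minimal_graded_free_resolution I s \<phi>"
    and \<beta>_def: "\<beta> = (\<lambda>i j. count_list (s i) j)"
    using \<beta> unfolding graded_betti_numbers_def by (elim exE conjE)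
  have s: "s i ! b = i + d" if "b < length (s i)" for i b
    using lin nth_mem[OF that] unfolding \<beta>_def by (metis count_list_0_iff)
  define r where "r i = (case i of 0 \<Rightarrow> 1 | Suc i \<Rightarrow> length (s i))" for i
  have r: "r 0 = 1" "r (Suc i) = length (s i)" for i by (simp_all add: r_def)
  define A where "A i a b = \<phi> i $$ (a, b)" for i a b
  have \<phi>0: "\<phi> 0 \<in> carrier_mat 1 (length (s 0))"
    and \<phi>Suc: "\<forall>i. \<phi> (Suc i) \<in> carrier_mat (length (s i)) (length (s (Suc i)))"
    and hom0: "\<forall>b<length (s 0). \<phi> 0 $$ (0, b) \<in> graded_component (s 0 ! b)"
    and hom: "\<forall>i. \<forall>a<length (s i). \<forall>b<length (s (Suc i)). \<forall>m\<in>Poly_Mapping.keys (\<phi> (Suc i) $$ (a, b)).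
        monom_degree m + s i ! a = s (Suc i) ! b"
    and img: "(\<lambda>u. vec_index (\<phi> 0 *\<^sub>v u) 0) ` carrier_vec (length (s 0)) = I"
    and ker: "\<forall>i. mat_kernel (\<phi> i) = (\<lambda>u. \<phi> (Suc i) *\<^sub>v u) ` carrier_vec (length (s (Suc i)))"
    by (insert res[unfolded minimal_graded_free_resolution_def], (elim conjE, assumption)+)
  have \<phi>: "\<phi> i \<in> carrier_mat (r i) (r (Suc i))" for i
    using \<phi>0 \<phi>Suc by (cases i) (simp_all add: r)
  have apply_vec: "(\<phi> i *\<^sub>v v) $ a = matrix_apply (A i) (r (Suc i)) (\<lambda>b. v $ b) a"
    if "v \<in> carrier_vec (r (Suc i))" "a < r i" for i v a
    using mult_mat_vec_index[OF \<phi> that] by (simp add: A_def[abs_def])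
  have apply_fun: "(\<phi> i *\<^sub>v vec (r (Suc i)) u) $ a = matrix_apply (A i) (r (Suc i)) u a"
    if "a < r i" for i u a
    using apply_vec[OF _ that, of "vec (r (Suc i)) u"] matrix_apply_cong[of "r (Suc i)" "\<lambda>b. vec (r (Suc i)) u $ b" u]
    by simp
  have exact: "(\<forall>a<r i. matrix_apply (A i) (r (Suc i)) u a = 0) \<longleftrightarrow>
      (\<exists>w. \<forall>b<r (Suc i). u b = matrix_apply (A (Suc i)) (r (Suc (Suc i))) w b)" for i u
  proof -
    have "(\<forall>a<r i. matrix_apply (A i) (r (Suc i)) u a = 0) \<longleftrightarrow> \<phi> i *\<^sub>v vec (r (Suc i)) u = 0\<^sub>v (r i)"
      using \<phi>[of i] apply_fun[of _ i u] by (auto simp: vec_eq_iff)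
    also have "\<dots> \<longleftrightarrow> vec (r (Suc i)) u \<in> mat_kernel (\<phi> i)"
      using \<phi>[of i] by (auto simp: mat_kernel)
    also have "\<dots> \<longleftrightarrow> (\<exists>w\<in>carrier_vec (r (Suc (Suc i))). vec (r (Suc i)) u = \<phi> (Suc i) *\<^sub>v w)"
      using spec[OF ker, of i] by (auto simp: r)
    also have "\<dots> \<longleftrightarrow> (\<exists>w. \<forall>b<r (Suc i). u b = matrix_apply (A (Suc i)) (r (Suc (Suc i))) w b)"
    proof
      assume "\<exists>w\<in>carrier_vec (r (Suc (Suc i))). vec (r (Suc i)) u = \<phi> (Suc i) *\<^sub>v w"
      then obtain w where w: "w \<in> carrier_vec (r (Suc (Suc i)))" "vec (r (Suc i)) u = \<phi> (Suc i) *\<^sub>v w" by auto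
      have "u b = matrix_apply (A (Suc i)) (r (Suc (Suc i))) (\<lambda>b. w $ b) b" if "b < r (Suc i)" for b
        using arg_cong[OF w(2), of "\<lambda>x. vec_index x b"] apply_vec[OF w(1) that] that by simp
      then show "\<exists>w. \<forall>b<r (Suc i). u b = matrix_apply (A (Suc i)) (r (Suc (Suc i))) w b" by auto
    next
      assume "\<exists>w. \<forall>b<r (Suc i). u b = matrix_apply (A (Suc i)) (r (Suc (Suc i))) w b"
      then obtain w where w: "\<forall>b<r (Suc i). u b = matrix_apply (A (Suc i)) (r (Suc (Suc i))) w b" by auto
      have "vec (r (Suc i)) u = \<phi> (Suc i) *\<^sub>v vec (r (Suc (Suc i))) w"
        using \<phi>[of "Suc i"] w apply_fun[of _ "Suc i" w] by (auto simp: vec_eq_iff)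
      then show "\<exists>w\<in>carrier_vec (r (Suc (Suc i))). vec (r (Suc i)) u = \<phi> (Suc i) *\<^sub>v w" by auto
    qed
    finally show ?thesis .
  qed
  have "I = range (\<lambda>u. matrix_apply (A 0) (r 1) u 0)"
  proof (intro equalityI subsetI)
    fix x assume "x \<in> I"
    then obtain u where u: "u \<in> carrier_vec (r (Suc 0))" "x = (\<phi> 0 *\<^sub>v u) $ 0"
      using img by (auto simp: r)
    then show "x \<in> range (\<lambda>u. matrix_apply (A 0) (r 1) u 0)"
      using apply_vec[of u 0 0] r(1) by auto
  next
    fix x assume "x \<in> range (\<lambda>u. matrix_apply (A 0) (r 1) u 0)"
    then obtain u where "x = (\<phi> 0 *\<^sub>v vec (r (Suc 0)) u) $ 0"
      using apply_fun[of 0 0] r(1) by auto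
    then show "x \<in> I" using img by (auto simp: r)
  qed
  moreover have "\<forall>b<r 1. A 0 0 b \<in> graded_component d"
    using hom0 s[of _ 0] r(2)[of 0] by (simp add: A_def)
  moreover have "\<forall>i. \<forall>a<r (Suc i). \<forall>b<r (Suc (Suc i)). A (Suc i) a b \<in> graded_component 1"
  proof (intro allI impI)
    fix i a b assume ab: "a < r (Suc i)" "b < r (Suc (Suc i))"
    then have "s i ! a = i + d" "s (Suc i) ! b = Suc i + d" using s by (auto simp: r)
    then show "A (Suc i) a b \<in> graded_component 1"
      using hom ab by (fastforce simp: graded_component_def A_def r)
  qed
  ultimately show ?thesis using that[of G d r A] G r(1) exact by blast
qed

text \<open>
  A Koszul chain of degree at least \<open>2\<close> that is a cycle modulo \<open>I\<close> is a boundary modulo \<open>I\<close>. The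
  element \<open>f\<close> ensures that the generators of \<open>I\<close> have degree at most \<open>2\<close>.
\<close>

lemma linear_resolution_koszul_boundary:
  fixes I :: "('v::finite, 'k::field) mpoly set"
  assumes lin: "has_linear_resolution I"
    and quadric: "f \<in> I" "m \<in> Poly_Mapping.keys f" "monom_degree m = 2"
    and proper: "I \<subseteq> weight_ideal monom_degree 1"
    and c: "\<And>\<sigma>. c \<sigma> \<in> weight_ideal monom_degree 2"
    and cyc: "\<And>\<tau>. koszul_diff c \<tau> \<in> I"
  shows "\<exists>b. \<forall>\<sigma>. c \<sigma> - koszul_diff b \<sigma> \<in> I"
proof -
  obtain d G r and A :: "nat \<Rightarrow> nat \<Rightarrow> nat \<Rightarrow> ('v, 'k) mpoly" where
    G: "G \<subseteq> graded_component d" "I = Idl\<^bsub>mpoly_ring\<^esub> G" and r0: "r 0 = 1"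
    and I: "I = range (\<lambda>u. matrix_apply (A 0) (r 1) u 0)"
    and exact: "\<forall>i u. (\<forall>a<r i. matrix_apply (A i) (r (Suc i)) u a = 0) \<longleftrightarrow>
      (\<exists>w. \<forall>b<r (Suc i). u b = matrix_apply (A (Suc i)) (r (Suc (Suc i))) w b)"
    and A0: "\<forall>b<r 1. A 0 0 b \<in> graded_component d"
    and ASuc: "\<forall>i. \<forall>a<r (Suc i). \<forall>b<r (Suc (Suc i)). A (Suc i) a b \<in> graded_component 1"
    using lin by (rule linear_resolution_cases)
  have "I \<subseteq> weight_ideal monom_degree d"
    unfolding G(2) using G(1)
    by (intro Idl_minimal deg.ideal_weight_ideal) (auto simp: weight_ideal_def graded_component_def)
  then have d2: "d \<le> 2" using quadric weight_idealD by fastforce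
  have "\<exists>u. (\<forall>b. u b \<in> weight_ideal monom_degree 1) \<and> koszul_diff c \<tau> = matrix_apply (A 0) (r 1) u 0" for \<tau>
  proof -
    obtain u where u: "koszul_diff c \<tau> = matrix_apply (A 0) (r 1) u 0"
      using cyc[of \<tau>] unfolding I by auto
    have "koszul_diff c \<tau> \<in> weight_ideal monom_degree (Suc d)"
      using koszul_diff_weight_ideal[where c = c and d = 2 and \<tau> = \<tau>, OF c] d2 by (auto simp: weight_ideal_def)
    then obtain u' where "\<forall>b. u' b \<in> weight_ideal monom_degree 1"
        "\<forall>a<1. koszul_diff c \<tau> = matrix_apply (A 0) (r 1) u' a"
      by (rule lift_without_constant_term[of 1 "r 1" "A 0" d "\<lambda>_. koszul_diff c \<tau>" u, rotated])
        (use u A0 in auto)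
    then show ?thesis by auto
  qed
  then have "\<forall>\<tau>. \<exists>u. (\<forall>b. u b \<in> weight_ideal monom_degree 1) \<and> koszul_diff c \<tau> = matrix_apply (A 0) (r 1) u 0"
    by (rule allI)
  from choice[OF this] obtain c' where c': "\<forall>\<tau>. (\<forall>b. c' \<tau> b \<in> weight_ideal monom_degree 1) \<and>
      koszul_diff c \<tau> = matrix_apply (A 0) (r 1) (c' \<tau>) 0"
    by (rule exE)
  have "\<exists>b b'. \<forall>\<sigma>. \<forall>a<r (Suc 0). c' \<sigma> a =
    koszul_diff (\<lambda>\<sigma>. b \<sigma> a) \<sigma> + matrix_apply (A (Suc 0)) (r (Suc (Suc 0))) (b' \<sigma>) a"
  \<comment> \<open>No chain has components of homological degree above the number of variables.\<close>
  proof (rule koszul_chase[of r A 0 c' "card (UNIV :: 'v set)"])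
    show "A (Suc i) a b \<in> graded_component 1" if "a < r (Suc i)" "b < r (Suc (Suc i))" for i a b
      using ASuc that by blast
    show "c' \<sigma> b = 0" if "card (UNIV :: 'v set) < card \<sigma>" for \<sigma> b
      using that card_mono[of UNIV \<sigma>] by simp
    fix \<tau> a assume "a < r 0"
    then have [simp]: "a = 0" using r0 by simp
    have "matrix_apply (A 0) (r (Suc 0)) (\<lambda>b. koszul_diff (\<lambda>\<sigma>. c' \<sigma> b) \<tau>) a =
        koszul_diff (\<lambda>\<sigma>. matrix_apply (A 0) (r 1) (c' \<sigma>) 0) \<tau>"
      by (simp add: koszul_diff_matrix_apply)
    also have "(\<lambda>\<sigma>. matrix_apply (A 0) (r 1) (c' \<sigma>) 0) = koszul_diff c"
      using c' by auto
    finally show "matrix_apply (A 0) (r (Suc 0)) (\<lambda>b. koszul_diff (\<lambda>\<sigma>. c' \<sigma> b) \<tau>) a = 0"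
      by (simp add: koszul_diff_koszul_diff)
  qed (use exact c' in auto)
  then obtain b b' where b: "\<forall>\<sigma>. \<forall>a<r (Suc 0). c' \<sigma> a =
    koszul_diff (\<lambda>\<sigma>. b \<sigma> a) \<sigma> + matrix_apply (A (Suc 0)) (r (Suc (Suc 0))) (b' \<sigma>) a"
    by (elim exE)
  have "\<exists>b''. \<forall>\<sigma>. c \<sigma> - matrix_apply (A 0) (r 1) (b \<sigma>) 0 = koszul_diff b'' \<sigma>"
  proof (rule koszul_exact)
    fix \<tau>
    have "\<forall>q<r (Suc 0). c' \<tau> q - koszul_diff (\<lambda>\<sigma>. b \<sigma> q) \<tau> =
        matrix_apply (A (Suc 0)) (r (Suc (Suc 0))) (b' \<tau>) q"
      using b by simp
    then have "\<exists>w. \<forall>q<r (Suc 0). c' \<tau> q - koszul_diff (\<lambda>\<sigma>. b \<sigma> q) \<tau> =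
        matrix_apply (A (Suc 0)) (r (Suc (Suc 0))) w q"
      by (rule exI[of _ "b' \<tau>"])
    then have "\<forall>a<r 0. matrix_apply (A 0) (r (Suc 0)) (\<lambda>q. c' \<tau> q - koszul_diff (\<lambda>\<sigma>. b \<sigma> q) \<tau>) a = 0"
      using spec[OF spec[OF exact, of 0], of "\<lambda>q. c' \<tau> q - koszul_diff (\<lambda>\<sigma>. b \<sigma> q) \<tau>"]
      by (rule iffD2[rotated])
    then have "matrix_apply (A 0) (r (Suc 0)) (\<lambda>q. c' \<tau> q - koszul_diff (\<lambda>\<sigma>. b \<sigma> q) \<tau>) 0 = 0"
      using r0 by simp
    then show "koszul_diff (\<lambda>\<sigma>. c \<sigma> - matrix_apply (A 0) (r 1) (b \<sigma>) 0) \<tau> = 0"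
      using c' by (simp add: koszul_diff_diff koszul_diff_matrix_apply matrix_apply_diff)
  next
    have "matrix_apply (A 0) (r 1) (b {}) 0 \<in> weight_ideal monom_degree 1"
      using proper I by blast
    moreover have "c {} \<in> weight_ideal monom_degree 1"
      using c[of "{}"] by (auto simp: weight_ideal_def)
    ultimately show "Poly_Mapping.lookup (c {} - matrix_apply (A 0) (r 1) (b {}) 0) 0 = 0"
      by (simp add: weight_ideal_1_iff lookup_minus del: One_nat_def)
  qed
  then obtain b'' where b'': "\<forall>\<sigma>. c \<sigma> - matrix_apply (A 0) (r 1) (b \<sigma>) 0 = koszul_diff b'' \<sigma>"
    by (rule exE)
  have "c \<sigma> - koszul_diff b'' \<sigma> = matrix_apply (A 0) (r 1) (b \<sigma>) 0" for \<sigma>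
    using spec[OF b'', of \<sigma>] by (simp add: algebra_simps)
  then show ?thesis using I by (intro exI[of _ b'']) auto
qed

section \<open>Edge ideals with a linear resolution\<close>

lemma edge_ideal_subset:
  assumes "ideal J mpoly_ring" "\<And>i j. {i, j} \<in> E \<Longrightarrow> mvar i * mvar j \<in> J"
  shows "edge_ideal E \<subseteq> J"
  unfolding edge_ideal_def by (rule Idl_minimal[OF assms(1)]) (use assms(2) in auto)

lemma mvar_mult_mvar:
  "mvar i * mvar j = (Poly_Mapping.single (Poly_Mapping.single i 1 + Poly_Mapping.single j 1) 1 ::
     ('v::finite, 'k::field) mpoly)"
  by (simp add: mvar_def mult_single)

lemma keys_edge_ideal:
  fixes f :: "('v::finite, 'k::field) mpoly"
  assumes "f \<in> edge_ideal E" "m \<in> Poly_Mapping.keys f"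
  obtains i j where "{i, j} \<in> E" "Poly_Mapping.lookup m i \<noteq> 0" "Poly_Mapping.lookup m j \<noteq> 0"
proof -
  define J :: "('v, 'k) mpoly set" where "J = {f. \<forall>m\<in>Poly_Mapping.keys f.
    \<exists>i j. {i, j} \<in> E \<and> Poly_Mapping.lookup m i \<noteq> 0 \<and> Poly_Mapping.lookup m j \<noteq> 0}"
  have "edge_ideal E \<subseteq> J"
  proof (rule edge_ideal_subset)
    show "ideal J mpoly_ring"
    proof (rule mpoly_idealI)
      show "f + g \<in> J" if "f \<in> J" "g \<in> J" for f g
        using that unfolding J_def by (auto dest!: keys_add_cases)
      show "f * g \<in> J" if "g \<in> J" for f g
        using that unfolding J_def by (fastforce elim!: keys_mult_obtain simp: lookup_add)
    qed (simp add: J_def)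
    show "mvar i * mvar j \<in> J" if "{i, j} \<in> E" for i j
      using that by (simp add: mvar_mult_mvar J_def lookup_add) (rule exI[of _ i], rule exI[of _ j], simp)
  qed
  then show ?thesis using assms that unfolding J_def by blast
qed

text \<open>
  The complement of a graph is chordal if the edge ideal of the graph has a linear resolution.
\<close>

lemma linear_edge_ideal_cut_chordal:
  fixes E :: "'v::finite set set"
  assumes simple: "\<forall>e\<in>E. card e = 2" and nonempty: "E \<noteq> {}"
    and lin: "has_linear_resolution (edge_ideal E :: ('v, 'k::field) mpoly set)"
  shows "cut_chordal (\<lambda>u v. u \<noteq> v \<and> {u, v} \<notin> E)" (is "cut_chordal ?H")
  unfolding cut_chordal_def
proof (intro allI impI)
  fix W a b assume aW: "a \<in> W" and bW: "b \<in> W" and ab: "?H a b"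
    and common: "\<forall>w\<in>W. \<not> (?H w a \<and> ?H w b)"
  let ?I = "edge_ideal E :: ('v, 'k) mpoly set"
  obtain i j where ij: "{i, j} \<in> E" "i \<noteq> j"
    using simple nonempty by (metis card_2_iff ex_in_conv)
  have I2: "?I \<subseteq> weight_ideal monom_degree 2"
    by (rule edge_ideal_subset[OF deg.ideal_weight_ideal])
      (simp add: mvar_mult_mvar weight_ideal_def monom_degree_add del: One_nat_def)
  define c :: "'v set \<Rightarrow> ('v, 'k) mpoly" where
    "c \<sigma> = (if \<sigma> = W - {a, b} then mvar a * mvar b else 0)" for \<sigma>
  have c_cycle: "koszul_diff c \<tau> \<in> ?I" for \<tau>
    unfolding koszul_diff_def
  proof (rule mpoly_ideal_sum[OF ideal_edge_ideal])
    fix v assume v: "v \<in> - \<tau>"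
    show "koszul_sign v \<tau> * mvar v * c (insert v \<tau>) \<in> ?I"
    proof (cases "insert v \<tau> = W - {a, b}")
      case True
      then have "{v, a} \<in> E \<or> {v, b} \<in> E" using common by auto
      then have "mvar v * mvar a * mvar b \<in> ?I"
      proof
        assume "{v, a} \<in> E"
        then show ?thesis
          using mpoly_idealD(3)[OF ideal_edge_ideal mvar_mult_in_edge_ideal, of v a E "mvar b"]
          by (simp add: mult_ac)
      next
        assume "{v, b} \<in> E"
        then show ?thesis
          using mpoly_idealD(3)[OF ideal_edge_ideal mvar_mult_in_edge_ideal, of v b E "mvar a"]
          by (simp add: mult_ac)
      qed
      then show ?thesis
        using mpoly_idealD(3)[OF ideal_edge_ideal, of "mvar v * mvar a * mvar b" E "koszul_sign v \<tau>"] True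
        by (simp add: c_def mult_ac)
    qed (simp add: c_def mpoly_idealD(1)[OF ideal_edge_ideal])
  qed
  have "\<exists>p. \<forall>\<sigma>. c \<sigma> - koszul_diff p \<sigma> \<in> ?I"
  proof (rule linear_resolution_koszul_boundary[OF lin])
    show "mvar i * mvar j \<in> ?I" by (rule mvar_mult_in_edge_ideal[OF ij(1)])
    show "Poly_Mapping.single i 1 + Poly_Mapping.single j 1 \<in> Poly_Mapping.keys (mvar i * mvar j :: ('v, 'k) mpoly)"
      by (simp add: mvar_mult_mvar)
    show "monom_degree (Poly_Mapping.single i 1 + Poly_Mapping.single j 1) = 2"
      by (simp add: monom_degree_add del: One_nat_def)
    show "?I \<subseteq> weight_ideal monom_degree 1" using I2 by (fastforce simp: weight_ideal_def)
    show "c \<sigma> \<in> weight_ideal monom_degree 2" for \<sigma>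
      by (simp add: c_def mvar_mult_mvar weight_ideal_def monom_degree_add del: One_nat_def)
  qed (rule c_cycle)
  then obtain p where p: "\<forall>\<sigma>. c \<sigma> - koszul_diff p \<sigma> \<in> ?I" by (rule exE)
  \<comment> \<open>For \<open>\<tau> = W - {u, v}\<close>, the coefficient of \<open>x\<^sub>u x\<^sub>v\<close> in the component \<open>\<tau>\<close> of the boundary of \<open>p\<close> only
    involves the components \<open>insert u \<tau> = W - {v}\<close> and \<open>insert v \<tau> = W - {u}\<close> of \<open>p\<close>. With the sign in \<open>B\<close>
    it becomes \<open>\<pm>(B u - B v)\<close>. It equals the coefficient in \<open>c\<close>, since \<open>x\<^sub>u x\<^sub>v \<notin> I\<close>.\<close>
  define q where "q v = Poly_Mapping.lookup (p (W - {v})) (Poly_Mapping.single v 1)" for v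
  define B :: "'v \<Rightarrow> 'k" where "B v = koszul_sign v W * q v" for v
  have eq: "Poly_Mapping.lookup (c (W - {u, v})) (Poly_Mapping.single u 1 + Poly_Mapping.single v 1) = 0 \<longleftrightarrow> B u = B v"
    if uv: "u \<in> W" "v \<in> W" "?H u v" for u v
  proof -
    let ?m = "Poly_Mapping.single u 1 + Poly_Mapping.single v 1 :: 'v monom"
    define \<tau> where "\<tau> = W - {u, v}"
    have \<tau>: "u \<notin> \<tau>" "v \<notin> \<tau>" "W = insert u (insert v \<tau>)" using uv by (auto simp: \<tau>_def)
    have ins: "insert u \<tau> = W - {v}" "insert v \<tau> = W - {u}" using \<tau> uv by auto
    have "?m \<notin> Poly_Mapping.keys (c \<tau> - koszul_diff p \<tau>)"
    proof
      assume "?m \<in> Poly_Mapping.keys (c \<tau> - koszul_diff p \<tau>)"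
      with spec[OF p, of \<tau>] obtain x y where xy: "{x, y} \<in> E" "Poly_Mapping.lookup ?m x \<noteq> 0" "Poly_Mapping.lookup ?m y \<noteq> 0"
        by (rule keys_edge_ideal)
      have "x \<noteq> y" using simple xy(1) by auto
      moreover have "x \<in> {u, v}" "y \<in> {u, v}"
        using xy(2,3) by (auto simp: lookup_add lookup_single when_def split: if_splits)
      ultimately have "{x, y} = {u, v}" by auto
      then show False using uv xy by simp
    qed
    then have "Poly_Mapping.lookup (c \<tau>) ?m = Poly_Mapping.lookup (koszul_diff p \<tau>) ?m"
      by (simp add: in_keys_iff lookup_minus)
    also have "\<dots> = (\<Sum>w\<in>- \<tau>. koszul_sign w \<tau> *
        (if Poly_Mapping.lookup ?m w = 0 then 0 else Poly_Mapping.lookup (p (insert w \<tau>)) (?m - Poly_Mapping.single w 1)))"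
      by (simp only: koszul_diff_def lookup_sum mult.assoc lookup_koszul_sign_times lookup_mvar_times)
    also have "\<dots> = (\<Sum>w\<in>{u, v}. koszul_sign w \<tau> *
        (if Poly_Mapping.lookup ?m w = 0 then 0 else Poly_Mapping.lookup (p (insert w \<tau>)) (?m - Poly_Mapping.single w 1)))"
      using \<tau> by (intro sum.mono_neutral_right) (auto simp: lookup_add lookup_single when_def)
    also have "\<dots> = koszul_sign u \<tau> * q v + koszul_sign v \<tau> * q u"
    proof -
      have "?m - Poly_Mapping.single u 1 = Poly_Mapping.single v 1" "?m - Poly_Mapping.single v 1 = Poly_Mapping.single u 1"
        by simp_all
      then show ?thesis
        using uv by (simp add: lookup_add lookup_single q_def ins del: One_nat_def)
    qed
    finally have L: "Poly_Mapping.lookup (c \<tau>) ?m = koszul_sign u \<tau> * q v + koszul_sign v \<tau> * q u" .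
    define s t :: 'k where "s = koszul_sign u \<tau>" and "t = koszul_sign v \<tau>"
    have st: "s * s = 1" "t * t = 1" by (simp_all add: s_def t_def)
    have "to_nat u \<noteq> to_nat v" using uv by (simp add: inj_eq)
    then consider "to_nat u < to_nat v" | "to_nat v < to_nat u" by linarith
    then have "B u = s * q u \<and> B v = - (t * q v) \<or> B u = - (s * q u) \<and> B v = t * q v"
      using \<tau> uv by cases (simp_all add: B_def koszul_sign_insert s_def t_def)
    then have "B u = B v \<longleftrightarrow> s * q u = - (t * q v)" by auto
    also have "\<dots> \<longleftrightarrow> s * t * (s * q u) = s * t * - (t * q v)"
    proof -
      have "s * t \<noteq> 0" using st by auto
      then show ?thesis by (simp only: mult_cancel_left) simp
    qed
    also have "\<dots> \<longleftrightarrow> t * q u = - (s * q v)"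
    proof -
      have "s * t * (s * q u) = (s * s) * (t * q u)" "s * t * - (t * q v) = (t * t) * - (s * q v)"
        by (simp_all add: mult_ac)
      then show ?thesis by (simp only: st mult_1_left)
    qed
    also have "\<dots> \<longleftrightarrow> Poly_Mapping.lookup (c \<tau>) ?m = 0"
      unfolding L s_def t_def by (metis add.commute eq_neg_iff_add_eq_0)
    finally show ?thesis by (simp add: \<tau>_def)
  qed
  show "edge_separated ?H W a b"
    unfolding edge_separated_def
  proof (intro exI[of _ "\<lambda>v. B v = B a"] conjI ballI impI)
    have "B a \<noteq> B b"
      using eq[OF aW bW ab] by (auto simp: c_def mvar_mult_mvar)
    then show "(B a = B a) \<noteq> (B b = B a)" by simp
    show "(B u = B a) = (B v = B a)" if "u \<in> W" "v \<in> W" "?H u v" "{u, v} \<noteq> {a, b}" for u v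
    proof -
      have "W - {u, v} \<noteq> W - {a, b}"
        using that aW bW by blast
      then have "B u = B v" using eq[OF that(1-3)] by (simp add: c_def)
      then show ?thesis by simp
    qed
  qed
qed

text \<open>
  A simplicial vertex of the complement that lies on some edge.
\<close>

lemma dominating_neighbourhood:
  fixes E :: "'v::finite set set"
  assumes simple: "\<forall>e\<in>E. card e = 2" and nonempty: "E \<noteq> {}"
    and chordal: "cut_chordal (\<lambda>u v. u \<noteq> v \<and> {u, v} \<notin> E)"
  obtains y y' where "{y, y'} \<in> E" "\<And>i j. {i, j} \<in> E \<Longrightarrow> {y, i} \<in> E \<or> {y, j} \<in> E"
proof -
  let ?H = "\<lambda>u v. u \<noteq> v \<and> {u, v} \<notin> E"
  have "\<not> (\<forall>x\<in>UNIV. \<forall>y\<in>UNIV. x \<noteq> y \<longrightarrow> ?H x y)"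
    using simple nonempty by (metis UNIV_I card_2_iff ex_in_conv)
  then have "\<exists>y\<in>UNIV. \<exists>y'\<in>UNIV. y \<noteq> y' \<and> \<not> ?H y y' \<and> simplicial_in ?H UNIV y \<and> simplicial_in ?H UNIV y'"
    using clique_or_two_simplicial[of ?H UNIV] chordal by (auto simp: insert_commute)
  then obtain y y' where y: "{y, y'} \<in> E" "simplicial_in ?H UNIV y" by auto
  have "{y, i} \<in> E \<or> {y, j} \<in> E" if "{i, j} \<in> E" for i j
  proof (rule ccontr)
    assume no: "\<not> ({y, i} \<in> E \<or> {y, j} \<in> E)"
    have "i \<noteq> j" using simple that by auto
    moreover have "y \<noteq> i" "y \<noteq> j" using no that by (auto simp: insert_commute)
    ultimately show False using y(2) no that unfolding simplicial_in_def by blast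
  qed
  then show ?thesis using that y(1) by blast
qed

section \<open>The v-number of the powers\<close>

lemma mvar_power: "mvar v ^ k = (Poly_Mapping.single (Poly_Mapping.single v k) 1 :: ('v::finite, 'k::field) mpoly)"
  by (induction k) (simp_all add: mvar_def mult_single flip: single_add)

lemma v_number_ge:
  fixes f :: "('v::finite, 'k::field) mpoly"
  assumes edge: "{i, j} \<in> E"
    and f: "f \<in> graded_component d"
    and ass: "colon (ideal_power (edge_ideal E) k) f \<in> Ass (ideal_power (edge_ideal E) k)"
  shows "2 * k \<le> Suc d"
proof -
  let ?I = "edge_ideal E :: ('v, 'k) mpoly set"
  let ?P = "colon (ideal_power ?I k) f"
  have prime: "primeideal ?P mpoly_ring" using ass by (simp add: Ass_def)
  interpret primeideal ?P mpoly_ring by (fact prime)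
  have P_prime: "g \<in> ?P \<or> h \<in> ?P" if "g * h \<in> ?P" for g h using I_prime[of g h] that by simp
  have P_proper: "?P \<noteq> UNIV" using I_notcarr by simp
  have Ik: "ideal (ideal_power ?I k) mpoly_ring" by (rule ideal_ideal_power[OF ideal_edge_ideal])
  have P1: "1 \<notin> ?P"
    using P_proper mpoly_idealD(3)[OF ideal_axioms, of 1] by auto
  have power: "g \<in> ?P" if "g ^ n \<in> ?P" for g n
    using that by (induction n) (use P1 P_prime in auto)
  have "(mvar i * mvar j) ^ k \<in> ideal_power ?I k"
    by (rule power_in_ideal_power[OF mvar_mult_in_edge_ideal[OF edge]])
  then have "(mvar i * mvar j) ^ k \<in> ?P"
    using mpoly_idealD(3)[OF Ik, of "(mvar i * mvar j) ^ k" f] by (simp add: colon_def mult.commute)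
  then obtain v where "mvar v \<in> ?P" using power P_prime by blast
  then have v: "mvar v * f \<in> ideal_power ?I k" by (simp add: colon_def)
  have "f \<noteq> 0" using P_proper mpoly_idealD(1)[OF Ik] by (auto simp: colon_def)
  then obtain m where m: "m \<in> Poly_Mapping.keys f" by (metis ex_in_conv keys_eq_empty)
  have "?I \<subseteq> weight_ideal monom_degree 2"
    by (rule edge_ideal_subset[OF deg.ideal_weight_ideal])
      (simp add: mvar_mult_mvar weight_ideal_def monom_degree_add del: One_nat_def)
  then have "mvar v * f \<in> weight_ideal monom_degree (2 * k)"
    using deg.ideal_power_weight[of ?I 2 k] v by auto
  moreover have "Poly_Mapping.single v 1 + m \<in> Poly_Mapping.keys (mvar v * f)"
    using m by (simp add: mvar_def keys_monomial_times)
  ultimately have "2 * k \<le> monom_degree (Poly_Mapping.single v 1 + m)"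
    by (rule weight_idealD)
  then show ?thesis using f m by (simp add: monom_degree_add graded_component_def)
qed

lemma mpoly_eq_sum_terms:
  fixes g :: "('v::finite, 'k::field) mpoly"
  shows "g = (\<Sum>m\<in>Poly_Mapping.keys g. Poly_Mapping.single m (Poly_Mapping.lookup g m))"
  by (intro poly_mapping_eqI) (simp add: lookup_sum lookup_single when_def in_keys_iff)

text \<open>
  The degree of a monomial in the variables of \<open>C\<close>.
\<close>

definition part_degree :: "'v set \<Rightarrow> 'v::finite monom \<Rightarrow> nat" where
  "part_degree C m = (\<Sum>v\<in>C. Poly_Mapping.lookup m v)"

interpretation part: additive_weight "part_degree C" for C
  by unfold_locales (simp add: part_degree_def lookup_add sum.distrib)

lemma part_degree_single: "part_degree C (Poly_Mapping.single v n) = (if v \<in> C then n else 0)"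
  by (simp add: part_degree_def lookup_single when_def)

lemma weight_ideal_part_subset:
  fixes J :: "('v::finite, 'k::field) mpoly set"
  assumes J: "ideal J mpoly_ring" "\<And>v. v \<in> C \<Longrightarrow> mvar v \<in> J"
  shows "weight_ideal (part_degree C) 1 \<subseteq> J"
proof
  fix g :: "('v, 'k) mpoly" assume g: "g \<in> weight_ideal (part_degree C) 1"
  have "(\<Sum>m\<in>Poly_Mapping.keys g. Poly_Mapping.single m (Poly_Mapping.lookup g m)) \<in> J"
  proof (rule mpoly_ideal_sum[OF J(1)])
    fix m assume "m \<in> Poly_Mapping.keys g"
    then have "part_degree C m \<noteq> 0" using weight_idealD[OF g] by fastforce
    then obtain v where v: "v \<in> C" "Poly_Mapping.lookup m v \<noteq> 0"
      unfolding part_degree_def by (meson sum.not_neutral_contains_not_neutral)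
    have "Poly_Mapping.single m (Poly_Mapping.lookup g m) =
        Poly_Mapping.single (m - Poly_Mapping.single v 1) (Poly_Mapping.lookup g m) * mvar v"
      using monomial_minus_variable[OF v(2)] by (simp add: mvar_def mult_single add.commute del: One_nat_def)
    then show "Poly_Mapping.single m (Poly_Mapping.lookup g m) \<in> J"
      using mpoly_idealD(3)[OF J(1) J(2)[OF v(1)]] by simp
  qed
  then show "g \<in> J" by (simp flip: mpoly_eq_sum_terms)
qed

lemma ideal_colon:
  assumes "ideal I (mpoly_ring :: ('v::finite, 'k::field) mpoly ring)"
  shows "ideal (colon I f) mpoly_ring"
  by (rule mpoly_idealI) (auto simp: colon_def distrib_right mult.assoc intro: mpoly_idealD[OF assms])

lemma v_number_witness:
  fixes E :: "'v::finite set set"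
  assumes simple: "\<forall>e\<in>E. card e = 2" and k: "k \<ge> 1" and edge: "{y, y'} \<in> E"
    and cover: "\<And>i j. {i, j} \<in> E \<Longrightarrow> {y, i} \<in> E \<or> {y, j} \<in> E"
  shows "\<exists>f\<in>graded_component (2 * k - 1). colon (ideal_power (edge_ideal E :: ('v, 'k::field) mpoly set) k) f
    \<in> Ass (ideal_power (edge_ideal E) k)"
proof -
  let ?I = "edge_ideal E :: ('v, 'k) mpoly set"
  define C where "C = {v. {y, v} \<in> E}"
  define M where "M = Poly_Mapping.single y k + Poly_Mapping.single y' (k - 1)"
  define f :: "('v, 'k) mpoly" where "f = Poly_Mapping.single M 1"
  have yC: "y \<notin> C" "y' \<in> C" using simple edge by (auto simp: C_def)
  have f: "f = mvar y * (mvar y * mvar y') ^ (k - 1)"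
  proof -
    have "mvar y * (mvar y * mvar y') ^ (k - 1) = (mvar y ^ k * mvar y' ^ (k - 1) :: ('v, 'k) mpoly)"
      using k by (cases k) (simp_all add: power_mult_distrib mult_ac)
    then show ?thesis by (simp add: f_def M_def mvar_power mult_single)
  qed
  have I1: "?I \<subseteq> weight_ideal (part_degree C) 1"
  proof (rule edge_ideal_subset[OF part.ideal_weight_ideal])
    show "mvar i * mvar j \<in> weight_ideal (part_degree C) 1" if "{i, j} \<in> E" for i j
      using cover[OF that]
      by (auto simp: mvar_mult_mvar weight_ideal_def part.weight_add part_degree_single C_def)
  qed
  have Ik: "ideal (ideal_power ?I k) mpoly_ring" by (rule ideal_ideal_power[OF ideal_edge_ideal])
  have colon: "colon (ideal_power ?I k) f = weight_ideal (part_degree C) 1"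
  proof (intro equalityI subsetI)
    fix g assume "g \<in> colon (ideal_power ?I k) f"
    then have gf: "f * g \<in> weight_ideal (part_degree C) k"
      using part.ideal_power_weight[OF I1, of k] by (auto simp: colon_def mult.commute)
    show "g \<in> weight_ideal (part_degree C) 1"
      unfolding weight_ideal_def
    proof (intro CollectI ballI)
      fix m assume "m \<in> Poly_Mapping.keys g"
      then have "M + m \<in> Poly_Mapping.keys (f * g)" by (simp add: f_def keys_monomial_times)
      then have "k \<le> part_degree C (M + m)" using gf by (rule weight_idealD[rotated])
      then show "1 \<le> part_degree C m"
        using yC k by (simp add: M_def part.weight_add part_degree_single)
    qed
  next
    have "mvar v \<in> colon (ideal_power ?I k) f" if "v \<in> C" for v
    proof -
      have "mvar v * mvar y \<in> ?I"
        using mvar_mult_in_edge_ideal[of y v E] that by (simp add: C_def mult.commute)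
      then have "(mvar y * mvar y') ^ (k - 1) * (mvar v * mvar y) \<in> ideal_power ?I (Suc (k - 1))"
        by (intro mult_in_ideal_power_Suc power_in_ideal_power mvar_mult_in_edge_ideal[OF edge])
      then show ?thesis using k by (simp add: colon_def f mult_ac)
    qed
    then show "g \<in> colon (ideal_power ?I k) f" if "g \<in> weight_ideal (part_degree C) 1" for g
      using weight_ideal_part_subset[OF ideal_colon[OF Ik], of C f] that by blast
  qed
  have "f \<in> graded_component (2 * k - 1)"
    using k by (simp add: graded_component_def f_def M_def monom_degree_add)
  moreover have "primeideal (colon (ideal_power ?I k) f) mpoly_ring"
    unfolding colon by (rule part.primeideal_weight_ideal_1)
  then have "colon (ideal_power ?I k) f \<in> Ass (ideal_power ?I k)"
    by (auto simp: Ass_def)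
  ultimately show ?thesis by blast
qed

theorem theorem5p1:
  fixes E :: "'v::finite set set"
  assumes simple: "\<forall>e\<in>E. card e = 2"
    and nonempty: "E \<noteq> {}"
    and linear: "has_linear_resolution (edge_ideal E :: ('v, 'k::field) mpoly set)"
  shows "\<forall>k\<ge>1. v_number (ideal_power (edge_ideal E :: ('v, 'k) mpoly set) k) = 2 * k - 1"
proof (intro allI impI)
  fix k :: nat assume k: "k \<ge> 1"
  obtain y y' where y: "{y, y'} \<in> E" "\<And>i j. {i, j} \<in> E \<Longrightarrow> {y, i} \<in> E \<or> {y, j} \<in> E"
    using dominating_neighbourhood[OF simple nonempty linear_edge_ideal_cut_chordal[OF assms]] by metis
  show "v_number (ideal_power (edge_ideal E :: ('v, 'k) mpoly set) k) = 2 * k - 1"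
    unfolding v_number_def
  proof (rule Least_equality)
    show "\<exists>f\<in>graded_component (2 * k - 1). colon (ideal_power (edge_ideal E :: ('v, 'k) mpoly set) k) f
        \<in> Ass (ideal_power (edge_ideal E) k)"
      by (rule v_number_witness[OF simple k y])
    show "2 * k - 1 \<le> d" if "\<exists>f\<in>graded_component d. colon (ideal_power (edge_ideal E :: ('v, 'k) mpoly set) k) f
        \<in> Ass (ideal_power (edge_ideal E) k)" for d
      using that v_number_ge[OF y(1)] by fastforce
  qed
qed

end
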